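(* The following assertions (each universally closed over its free function variable $f$) are pairwise equivalent over $PRA_{fcn}$: 1. $MIN^3$: for ternary $f$, $(\forall m,n)(\exists r)(f(m,n,r)=0)\rightarrow(\exists g)(\forall m,n)(g(m,n)=(\mu r)(f(m,n,r)=0))$, $g$ binary; 2. $MIN^2$: for binary $f$, $(\forall m)(\exists n)(f(m,n)=0)\rightarrow(\exists g)(\forall m)(g(m)=(\mu n)(f(m,n)=0))$, $g$ unary; 3. $MIN^1$: for binary $f$, $(\forall m)(\exists! n)(f(m,n)=0)\rightarrow(\exists g)(\forall m)(f(m,g(m))=0)$, $g$ unary; 4. $PERM$: for unary $f$, $(\forall n)(\exists!m)(f(m)=n)\rightarrow(\exists g)(\forall n)(f(g(n))=n)$, $g$ unary.
   Context: The language $L_{fcn}$ is four-sorted: number variables ranging over $\omega$; function variables of arity 1, 2, 3 ranging over unary, binary, ternary functions on $\omega$; a constant $0$ and unary function symbol $S$ (successor). Terms are number variables, $0$, $S(t)$, and $f(t)$, $f(t,q)$, $f(t,q,r)$ for function variables of the corresponding arity; atomic formulas are equations of terms; formulas use connectives and quantifiers over numbers and functions of each arity. Free variables in axioms are read universally. $PRA_{fcn}$ consists of: (1) Successor axioms: $S(n)\neq 0$; $S(n)=S(m)\rightarrow n=m$; $n\neq 0\rightarrow(\exists m)(S(m)=n)$. (2) Initial function axioms: $(\exists f)(\forall m)(f(m)=n)$ ($f$ unary); ternary projections $(\exists f)(\forall m,n,r)(f(m,n,r)=m)$, and likewise with $=n$, $=r$; $(\exists f)(\forall n)(f(n)=S(n))$.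 (3) Composition axioms: (i) $(\exists f)(\forall m,n,r)(f(m,n,r)=g(m,n))$; (ii) $(\exists f)(\forall m,n,r)(f(m,n,r)=g(m))$; (iii) $(\exists f)(\forall m,n)(f(m,n)=g(m,n,r))$; (iv) $(\exists f)(\forall m)(f(m)=g(m,n,r))$; (v) $(\exists f)(\forall m,n,r)(f(m,n,r)=g(h_1(m,n,r),h_2(m,n,r),h_3(m,n,r)))$. (4) $PRA$: for unary $g$ and ternary $h$, $(\exists f)(\forall m)(f(m,0)=g(m)\wedge(\forall n)(f(m,S(n))=h(m,n,f(m,n))))$, $f$ binary. (6) Rudimentary induction: for unary $f,g$: $f(0)=g(0)\wedge(\forall n)(f(n)=g(n)\rightarrow f(S(n))=g(S(n)))\rightarrow f(n)=g(n)$. Notation: $g(m)=(\mu n)(f(m,n)=0)$ means $f(m,g(m))=0$ and $f(m,r)\neq 0$ for all $r<g(m)$, where $<$ is the natural strict order on $\omega$ (definable in $PRA_{fcn}$, e.g. $r<s$ iff $(\exists t)(r+S(t)=s)$ with $+$ given by primitive recursion); similarly for $(\mu r)(f(m,n,r)=0)$. $(\exists!)$ is the uniqueness quantifier. *)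

theory Defs
  imports Main
begin

text \<open>
  The four-sorted language of number variables and unary, binary and ternary function variables.
  Variables are de Bruijn indices, and each of the four sorts has its own index space: a quantifier
  over one sort binds index 0 of that sort and leaves the indices of the other sorts alone.
  There is no equality between functions.
\<close>

datatype arity = Una | Bin | Ter

datatype trm =
    Var nat
  | Zero
  | Succ trm
  | Ap1 nat trm
  | Ap2 nat trm trm
  | Ap3 nat trm trm trm

datatype fm =
    Falsum
  | Eq trm trm      (infix \<open>\<^bold>=\<close> 60)
  | Imp fm fm       (infixr \<open>\<^bold>\<longrightarrow>\<close> 56)
  | AllN fm
  | AllF arity fm

text \<open>The remaining connectives and quantifiers are the usual classical abbreviations.\<close>

definition Neg :: "fm \<Rightarrow> fm"  (\<open>\<^bold>\<not> _\<close> [59] 59) where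
  "\<^bold>\<not> p = (p \<^bold>\<longrightarrow> Falsum)"

definition Conj :: "fm \<Rightarrow> fm \<Rightarrow> fm"  (infixr \<open>\<^bold>\<and>\<close> 57) where
  "p \<^bold>\<and> q = (\<^bold>\<not> (p \<^bold>\<longrightarrow> \<^bold>\<not> q))"

definition Iff :: "fm \<Rightarrow> fm \<Rightarrow> fm"  (infix \<open>\<^bold>\<longleftrightarrow>\<close> 55) where
  "p \<^bold>\<longleftrightarrow> q = ((p \<^bold>\<longrightarrow> q) \<^bold>\<and> (q \<^bold>\<longrightarrow> p))"

definition ExN :: "fm \<Rightarrow> fm" where
  "ExN p = (\<^bold>\<not> AllN (\<^bold>\<not> p))"

definition ExF :: "arity \<Rightarrow> fm \<Rightarrow> fm" where
  "ExF a p = (\<^bold>\<not> AllF a (\<^bold>\<not> p))"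


section \<open>Substitution\<close>

text \<open>
  Simultaneous substitution of terms for number variables (\<open>s\<close>) and of function variables for
  function variables of the same arity (\<open>r\<close>); the only function terms are variables.
\<close>

primrec subst_trm :: "(nat \<Rightarrow> trm) \<Rightarrow> (arity \<Rightarrow> nat \<Rightarrow> nat) \<Rightarrow> trm \<Rightarrow> trm" where
  "subst_trm s r (Var i) = s i"
| "subst_trm s r Zero = Zero"
| "subst_trm s r (Succ t) = Succ (subst_trm s r t)"
| "subst_trm s r (Ap1 f t) = Ap1 (r Una f) (subst_trm s r t)"
| "subst_trm s r (Ap2 f t u) = Ap2 (r Bin f) (subst_trm s r t) (subst_trm s r u)"
| "subst_trm s r (Ap3 f t u v) =
     Ap3 (r Ter f) (subst_trm s r t) (subst_trm s r u) (subst_trm s r v)"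

definition id_fun :: "arity \<Rightarrow> nat \<Rightarrow> nat" where
  "id_fun = (\<lambda>_. id)"

definition suc_fun :: "arity \<Rightarrow> arity \<Rightarrow> nat \<Rightarrow> nat" where
  "suc_fun a = id_fun(a := Suc)"

definition lift_trm_N :: "trm \<Rightarrow> trm" where
  "lift_trm_N = subst_trm (\<lambda>i. Var (Suc i)) id_fun"

definition lift_trm_F :: "arity \<Rightarrow> trm \<Rightarrow> trm" where
  "lift_trm_F a = subst_trm Var (suc_fun a)"

primrec subst_fm :: "(nat \<Rightarrow> trm) \<Rightarrow> (arity \<Rightarrow> nat \<Rightarrow> nat) \<Rightarrow> fm \<Rightarrow> fm" where
  "subst_fm s r Falsum = Falsum"
| "subst_fm s r (t \<^bold>= u) = (subst_trm s r t \<^bold>= subst_trm s r u)"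
| "subst_fm s r (p \<^bold>\<longrightarrow> q) = (subst_fm s r p \<^bold>\<longrightarrow> subst_fm s r q)"
| "subst_fm s r (AllN p) =
     AllN (subst_fm (case_nat (Var 0) (\<lambda>i. lift_trm_N (s i))) r p)"
| "subst_fm s r (AllF a p) =
     AllF a (subst_fm (\<lambda>i. lift_trm_F a (s i)) (r(a := case_nat 0 (\<lambda>i. Suc (r a i)))) p)"

definition lift_N :: "fm \<Rightarrow> fm" where
  "lift_N = subst_fm (\<lambda>i. Var (Suc i)) id_fun"

definition lift_F :: "arity \<Rightarrow> fm \<Rightarrow> fm" where
  "lift_F a = subst_fm Var (suc_fun a)"

text \<open>Instantiation of the outermost bound variable of a quantified formula with body \<open>p\<close>.\<close>

definition inst_N :: "trm \<Rightarrow> fm \<Rightarrow> fm" where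
  "inst_N t p = subst_fm (case_nat t Var) id_fun p"

definition inst_F :: "arity \<Rightarrow> nat \<Rightarrow> fm \<Rightarrow> fm" where
  "inst_F a f p = subst_fm Var (id_fun(a := case_nat f id)) p"


section \<open>Classical natural deduction with equality\<close>

text \<open>
  In the introduction rules for quantifiers, lifting the hypotheses makes index 0 of the quantified
  sort fresh, which is the usual eigenvariable condition.
\<close>

inductive derives :: "fm set \<Rightarrow> fm \<Rightarrow> bool"  (infix \<open>\<turnstile>\<close> 50) where
  Assm: "p \<in> G \<Longrightarrow> G \<turnstile> p"
| ImpI: "insert p G \<turnstile> q \<Longrightarrow> G \<turnstile> p \<^bold>\<longrightarrow> q"
| ImpE: "G \<turnstile> p \<^bold>\<longrightarrow> q \<Longrightarrow> G \<turnstile> p \<Longrightarrow> G \<turnstile> q"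
| Classical: "insert (\<^bold>\<not> p) G \<turnstile> Falsum \<Longrightarrow> G \<turnstile> p"
| AllN_I: "lift_N ` G \<turnstile> p \<Longrightarrow> G \<turnstile> AllN p"
| AllN_E: "G \<turnstile> AllN p \<Longrightarrow> G \<turnstile> inst_N t p"
| AllF_I: "lift_F a ` G \<turnstile> p \<Longrightarrow> G \<turnstile> AllF a p"
| AllF_E: "G \<turnstile> AllF a p \<Longrightarrow> G \<turnstile> inst_F a f p"
| Refl: "G \<turnstile> t \<^bold>= t"
| Leibniz: "G \<turnstile> t \<^bold>= u \<Longrightarrow> G \<turnstile> inst_N t p \<Longrightarrow> G \<turnstile> inst_N u p"


section \<open>The theory\<close>

text \<open>
  Each set below lists the universal closures of the axioms, with the named form
  of each axiom next to it.
\<close>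

definition successor_axioms :: "fm set" where
  "successor_axioms = {
     \<comment> \<open>\<open>S(n) \<noteq> 0\<close>\<close>
     AllN (\<^bold>\<not> (Succ (Var 0) \<^bold>= Zero)),
     \<comment> \<open>\<open>S(n) = S(m) \<longrightarrow> n = m\<close>\<close>
     AllN (AllN (Succ (Var 1) \<^bold>= Succ (Var 0) \<^bold>\<longrightarrow> Var 1 \<^bold>= Var 0)),
     \<comment> \<open>\<open>n \<noteq> 0 \<longrightarrow> (\<exists>m) S(m) = n\<close>\<close>
     AllN (\<^bold>\<not> (Var 0 \<^bold>= Zero) \<^bold>\<longrightarrow> ExN (Succ (Var 0) \<^bold>= Var 1))}"

definition initial_function_axioms :: "fm set" where
  "initial_function_axioms = {
     \<comment> \<open>\<open>(\<exists>f)(\<forall>m) f(m) = n\<close>\<close>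
     AllN (ExF Una (AllN (Ap1 0 (Var 0) \<^bold>= Var 1))),
     \<comment> \<open>\<open>(\<exists>f)(\<forall>m,n,r) f(m,n,r) = m\<close>, then \<open>= n\<close>, then \<open>= r\<close>\<close>
     ExF Ter (AllN (AllN (AllN (Ap3 0 (Var 2) (Var 1) (Var 0) \<^bold>= Var 2)))),
     ExF Ter (AllN (AllN (AllN (Ap3 0 (Var 2) (Var 1) (Var 0) \<^bold>= Var 1)))),
     ExF Ter (AllN (AllN (AllN (Ap3 0 (Var 2) (Var 1) (Var 0) \<^bold>= Var 0)))),
     \<comment> \<open>\<open>(\<exists>f)(\<forall>n) f(n) = S(n)\<close>\<close>
     ExF Una (AllN (Ap1 0 (Var 0) \<^bold>= Succ (Var 0)))}"

definition composition_axioms :: "fm set" where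
  "composition_axioms = {
     \<comment> \<open>\<open>(\<exists>f)(\<forall>m,n,r) f(m,n,r) = g(m,n)\<close>\<close>
     AllF Bin (ExF Ter (AllN (AllN (AllN
       (Ap3 0 (Var 2) (Var 1) (Var 0) \<^bold>= Ap2 0 (Var 2) (Var 1)))))),
     \<comment> \<open>\<open>(\<exists>f)(\<forall>m,n,r) f(m,n,r) = g(m)\<close>\<close>
     AllF Una (ExF Ter (AllN (AllN (AllN
       (Ap3 0 (Var 2) (Var 1) (Var 0) \<^bold>= Ap1 0 (Var 2)))))),
     \<comment> \<open>\<open>(\<exists>f)(\<forall>m,n) f(m,n) = g(m,n,r)\<close>, closed over \<open>g, r\<close>\<close>
     AllF Ter (AllN (ExF Bin (AllN (AllN
       (Ap2 0 (Var 1) (Var 0) \<^bold>= Ap3 0 (Var 1) (Var 0) (Var 2)))))),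
     \<comment> \<open>\<open>(\<exists>f)(\<forall>m) f(m) = g(m,n,r)\<close>, closed over \<open>g, n, r\<close>\<close>
     AllF Ter (AllN (AllN (ExF Una (AllN
       (Ap1 0 (Var 0) \<^bold>= Ap3 0 (Var 0) (Var 2) (Var 1)))))),
     \<comment> \<open>\<open>(\<exists>f)(\<forall>m,n,r) f(m,n,r) = g(h1(m,n,r), h2(m,n,r), h3(m,n,r))\<close>,
        closed over \<open>g, h1, h2, h3\<close>, which have the indices 4, 3, 2, 1\<close>
     AllF Ter (AllF Ter (AllF Ter (AllF Ter (ExF Ter (AllN (AllN (AllN
       (Ap3 0 (Var 2) (Var 1) (Var 0) \<^bold>=
        Ap3 4 (Ap3 3 (Var 2) (Var 1) (Var 0))
              (Ap3 2 (Var 2) (Var 1) (Var 0))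
              (Ap3 1 (Var 2) (Var 1) (Var 0)))))))))) }"

definition primitive_recursion_axiom :: fm where
  \<comment> \<open>\<open>(\<exists>f)(\<forall>m)(f(m,0) = g(m) \<and> (\<forall>n) f(m,S(n)) = h(m,n,f(m,n)))\<close>, closed over \<open>g, h\<close>\<close>
  "primitive_recursion_axiom =
     AllF Una (AllF Ter (ExF Bin (AllN
       (Ap2 0 (Var 0) Zero \<^bold>= Ap1 0 (Var 0) \<^bold>\<and>
        AllN (Ap2 0 (Var 1) (Succ (Var 0)) \<^bold>=
              Ap3 0 (Var 1) (Var 0) (Ap2 0 (Var 1) (Var 0)))))))"

definition rudimentary_induction_axiom :: fm where
  \<comment> \<open>\<open>f(0) = g(0) \<and> (\<forall>n)(f(n) = g(n) \<longrightarrow> f(S(n)) = g(S(n))) \<longrightarrow> f(n) = g(n)\<close>,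
     closed over \<open>f, g, n\<close>; \<open>f\<close> has index 1 and \<open>g\<close> index 0\<close>
  "rudimentary_induction_axiom =
     AllF Una (AllF Una (AllN
       (Ap1 1 Zero \<^bold>= Ap1 0 Zero \<^bold>\<and>
        AllN (Ap1 1 (Var 0) \<^bold>= Ap1 0 (Var 0) \<^bold>\<longrightarrow>
              Ap1 1 (Succ (Var 0)) \<^bold>= Ap1 0 (Succ (Var 0)))
        \<^bold>\<longrightarrow> Ap1 1 (Var 0) \<^bold>= Ap1 0 (Var 0))))"

definition PRA_fcn :: "fm set" where
  "PRA_fcn = successor_axioms \<union> initial_function_axioms \<union> composition_axioms \<union>
     {primitive_recursion_axiom, rudimentary_induction_axiom}"


section \<open>Minimization and permutation principles\<close>

text \<open>
  The language has no symbol for addition, so \<open>t < u\<close> is expressed as: some binary \<open>p\<close> satisfies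
  \<open>p(m,0) = m\<close> and \<open>p(m,S(n)) = S(p(m,n))\<close> for all \<open>m, n\<close>, and \<open>p(t,S(k)) = u\<close> for some \<open>k\<close>.
\<close>

definition Less :: "trm \<Rightarrow> trm \<Rightarrow> fm"  (infix \<open>\<^bold><\<close> 60) where
  "t \<^bold>< u =
     ExF Bin
       (AllN (Ap2 0 (Var 0) Zero \<^bold>= Var 0 \<^bold>\<and>
              AllN (Ap2 0 (Var 1) (Succ (Var 0)) \<^bold>= Succ (Ap2 0 (Var 1) (Var 0))))
        \<^bold>\<and> ExN (Ap2 0 (lift_trm_N (lift_trm_F Bin t)) (Succ (Var 0)) \<^bold>=
                lift_trm_N (lift_trm_F Bin u)))"

text \<open>
  In \<open>Is_mu t p\<close>, which says \<open>t = (\<mu>n) p(n)\<close>, and in \<open>Ex1N p\<close>, number index 0 is bound in \<open>p\<close>.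
  The second copy of \<open>p\<close> in \<open>Ex1N p\<close> stands below two binders and has its own bound variable
  in place of the outer one.
\<close>

definition Is_mu :: "trm \<Rightarrow> fm \<Rightarrow> fm" where
  "Is_mu t p = (inst_N t p \<^bold>\<and> AllN (Var 0 \<^bold>< lift_trm_N t \<^bold>\<longrightarrow> \<^bold>\<not> p))"

definition Ex1N :: "fm \<Rightarrow> fm" where
  "Ex1N p =
     ExN (p \<^bold>\<and> AllN (subst_fm (case_nat (Var 0) (\<lambda>i. Var (i + 2))) id_fun p
                     \<^bold>\<longrightarrow> Var 0 \<^bold>= Var 1))"

definition MIN3 :: fm where
  \<comment> \<open>\<open>(\<forall>m,n)(\<exists>r) f(m,n,r) = 0 \<longrightarrow> (\<exists>g)(\<forall>m,n) g(m,n) = (\<mu>r)(f(m,n,r) = 0)\<close>\<close>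
  "MIN3 =
     AllF Ter (AllN (AllN (ExN (Ap3 0 (Var 2) (Var 1) (Var 0) \<^bold>= Zero)))
       \<^bold>\<longrightarrow> ExF Bin (AllN (AllN
             (Is_mu (Ap2 0 (Var 1) (Var 0)) (Ap3 0 (Var 2) (Var 1) (Var 0) \<^bold>= Zero)))))"

definition MIN2 :: fm where
  \<comment> \<open>\<open>(\<forall>m)(\<exists>n) f(m,n) = 0 \<longrightarrow> (\<exists>g)(\<forall>m) g(m) = (\<mu>n)(f(m,n) = 0)\<close>\<close>
  "MIN2 =
     AllF Bin (AllN (ExN (Ap2 0 (Var 1) (Var 0) \<^bold>= Zero))
       \<^bold>\<longrightarrow> ExF Una (AllN (Is_mu (Ap1 0 (Var 0)) (Ap2 0 (Var 1) (Var 0) \<^bold>= Zero))))"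

definition MIN1 :: fm where
  \<comment> \<open>\<open>(\<forall>m)(\<exists>!n) f(m,n) = 0 \<longrightarrow> (\<exists>g)(\<forall>m) f(m,g(m)) = 0\<close>\<close>
  "MIN1 =
     AllF Bin (AllN (Ex1N (Ap2 0 (Var 1) (Var 0) \<^bold>= Zero))
       \<^bold>\<longrightarrow> ExF Una (AllN (Ap2 0 (Var 0) (Ap1 0 (Var 0)) \<^bold>= Zero)))"

definition PERM :: fm where
  \<comment> \<open>\<open>(\<forall>n)(\<exists>!m) f(m) = n \<longrightarrow> (\<exists>g)(\<forall>n) f(g(n)) = n\<close>; below \<open>\<exists>g\<close>, \<open>f\<close> has index 1\<close>
  "PERM =
     AllF Una (AllN (Ex1N (Ap1 0 (Var 0) \<^bold>= Var 1))
       \<^bold>\<longrightarrow> ExF Una (AllN (Ap1 1 (Ap1 0 (Var 0)) \<^bold>= Var 0)))"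

end

theory Submission
  imports Defs "HOL-Library.Countable_Set"
begin

text \<open>
  By completeness of the calculus for Henkin models, in which the function variables range over
  given sets of functions, it suffices to prove the equivalences in every model. There the cycle
  \<open>MIN\<^sup>3 \<Longrightarrow> MIN\<^sup>2 \<Longrightarrow> MIN\<^sup>1 \<Longrightarrow> PERM \<Longrightarrow> MIN\<^sup>3\<close> is easy except for its last step. Given a ternary \<open>f\<close>,
  code the triple \<open>(m, n, r)\<close> by a number and consider the permutation which, on the row with fixed
  \<open>(m, n)\<close>, is the cycle \<open>0 \<mapsto> 1 \<mapsto> \<dots> \<mapsto> l \<mapsto> 0\<close>, where \<open>l\<close> is the least zero of \<open>f(m, n, \<cdot>)\<close>. It is
  primitive recursive in \<open>f\<close>, and its inverse maps \<open>(m, n, 0)\<close> to \<open>(m, n, l)\<close>.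
\<close>

section \<open>Substitution and derivability\<close>

lemma id_fun_apply [simp]: "id_fun a i = i"
  by (simp add: id_fun_def)

lemma subst_trm_cong:
  "(\<And>i. s i = s' i) \<Longrightarrow> (\<And>a i. r a i = r' a i) \<Longrightarrow> subst_trm s r t = subst_trm s' r' t"
  by (induction t) auto

lemma subst_trm_subst_trm:
  "subst_trm s' r' (subst_trm s r t) =
     subst_trm (\<lambda>i. subst_trm s' r' (s i)) (\<lambda>a i. r' a (r a i)) t"
  by (induction t) auto

lemma subst_trm_id: "(\<And>i. s i = Var i) \<Longrightarrow> (\<And>a i. r a i = i) \<Longrightarrow> subst_trm s r t = t"
  by (induction t) auto

text \<open>Under a number quantifier a substitution keeps the new index 0 and weakens all its
  values, so pushing it below the binder commutes with weakening. The binder case of the composition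
  law rests on this.\<close>

lemma lift_trm_N_subst_trm:
  "subst_trm (case_nat (Var 0) (\<lambda>i. lift_trm_N (s i))) r (lift_trm_N t) =
     lift_trm_N (subst_trm s r t)"
  by (simp add: lift_trm_N_def subst_trm_subst_trm)

lemma lift_trm_F_subst_trm:
  "subst_trm (\<lambda>i. lift_trm_F a (s i)) (r(a := case_nat 0 (\<lambda>i. Suc (r a i)))) (lift_trm_F a t) =
     lift_trm_F a (subst_trm s r t)"
  by (auto simp: lift_trm_F_def suc_fun_def subst_trm_subst_trm
      intro!: subst_trm_cong)

lemma subst_fm_cong:
  assumes "\<And>i. s i = s' i" "\<And>a i. r a i = r' a i"
  shows "subst_fm s r p = subst_fm s' r' p"
proof -
  have "s = s'" "r = r'" using assms by (auto simp: fun_eq_iff)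
  then show ?thesis by simp
qed

text \<open>Lifting and instantiation are themselves substitutions, so this composition law reduces
  the later identities among them to a pointwise comparison of variable assignments.\<close>

lemma subst_fm_subst_fm:
  "subst_fm s' r' (subst_fm s r p) =
     subst_fm (\<lambda>i. subst_trm s' r' (s i)) (\<lambda>a i. r' a (r a i)) p"
proof (induction p arbitrary: s r s' r')
  case (AllN p)
  show ?case
    by (auto simp: AllN lift_trm_N_subst_trm split: nat.split intro!: subst_fm_cong)
next
  case (AllF a p)
  show ?case
    by (simp add: AllF lift_trm_F_subst_trm del: fun_upd_apply)
      (auto split: nat.split intro!: subst_fm_cong)
qed (auto simp: subst_trm_subst_trm)

lemma subst_fm_id: "(\<And>i. s i = Var i) \<Longrightarrow> (\<And>a i. r a i = i) \<Longrightarrow> subst_fm s r p = p"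
proof (induction p arbitrary: s r)
  case (AllN p)
  then show ?case
    by (auto simp: lift_trm_N_def split: nat.split intro!: AllN.IH)
next
  case (AllF a p)
  then show ?case
    by (auto simp: lift_trm_F_def split: nat.split intro!: AllF.IH)
qed (auto simp: subst_trm_id)

lemma subst_fm_lift_N:
  "subst_fm (case_nat (Var 0) (\<lambda>i. lift_trm_N (s i))) r (lift_N p) = lift_N (subst_fm s r p)"
  by (simp add: lift_N_def lift_trm_N_def subst_fm_subst_fm)

lemma subst_fm_lift_F:
  "subst_fm (\<lambda>i. lift_trm_F a (s i)) (r(a := case_nat 0 (\<lambda>i. Suc (r a i)))) (lift_F a p) =
     lift_F a (subst_fm s r p)"
  by (auto simp: lift_F_def lift_trm_F_def suc_fun_def subst_fm_subst_fm
      intro!: subst_fm_cong)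

lemma inst_trm_lift_trm_N [simp]: "subst_trm (case_nat u Var) id_fun (lift_trm_N t) = t"
  unfolding lift_trm_N_def subst_trm_subst_trm by (rule subst_trm_id) auto

text \<open>Index 0 receives \<open>t\<close>, and the weakening of the other values is undone by
  the instantiation. In the truth lemma this turns an instance of a quantified formula into one
  longer substitution.\<close>

lemma inst_N_subst_fm:
  "inst_N t (subst_fm (case_nat (Var 0) (\<lambda>i. lift_trm_N (s i))) r p) =
     subst_fm (case_nat t s) r p"
  unfolding inst_N_def subst_fm_subst_fm
  by (auto split: nat.split intro!: subst_fm_cong)

lemma subst_fm_inst_N:
  "subst_fm s r (inst_N t p) =
     inst_N (subst_trm s r t) (subst_fm (case_nat (Var 0) (\<lambda>i. lift_trm_N (s i))) r p)"
  unfolding inst_N_subst_fm unfolding inst_N_def subst_fm_subst_fm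
  by (auto split: nat.split intro!: subst_fm_cong)

lemma inst_trm_lift_trm_F [simp]:
  "subst_trm Var (id_fun(a := case_nat f id)) (lift_trm_F a t) = t"
  unfolding lift_trm_F_def subst_trm_subst_trm by (rule subst_trm_id) (auto simp: suc_fun_def)

lemma inst_F_subst_fm:
  "inst_F a f (subst_fm (\<lambda>i. lift_trm_F a (s i)) (r(a := case_nat 0 (\<lambda>i. Suc (r a i)))) p) =
     subst_fm s (r(a := case_nat f (r a))) p"
  unfolding inst_F_def subst_fm_subst_fm
  by (auto split: nat.split intro!: subst_fm_cong)

lemma subst_fm_inst_F:
  "subst_fm s r (inst_F a f p) =
     inst_F a (r a f) (subst_fm (\<lambda>i. lift_trm_F a (s i)) (r(a := case_nat 0 (\<lambda>i. Suc (r a i)))) p)"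
  unfolding inst_F_subst_fm unfolding inst_F_def subst_fm_subst_fm
  by (auto split: nat.split intro!: subst_fm_cong)

section \<open>Weakening, substitution and compactness of derivations\<close>

lemma derives_mono: "G \<turnstile> p \<Longrightarrow> G \<subseteq> H \<Longrightarrow> H \<turnstile> p"
proof (induction arbitrary: H rule: derives.induct)
  case (ImpI p G q)
  then show ?case by (meson derives.ImpI insert_mono)
next
  case (Classical p G)
  then show ?case by (meson derives.Classical insert_mono)
next
  case (AllN_I G p)
  then show ?case by (meson derives.AllN_I image_mono)
next
  case (AllF_I a G p)
  then show ?case by (meson derives.AllF_I image_mono)
next
  case (Leibniz G t u p)
  then show ?case by (meson derives.Leibniz)
qed (auto intro: derives.intros)

text \<open>The quantifier introduction rules survive because a substitution pushed below the binder
  commutes with lifting the hypotheses. Its purpose is to rename a fresh variable to the bound index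
  0.\<close>

lemma derives_subst: "G \<turnstile> p \<Longrightarrow> subst_fm s r ` G \<turnstile> subst_fm s r p"
proof (induction arbitrary: s r rule: derives.induct)
  case (ImpE G p q)
  show ?case
    using derives.ImpE[OF ImpE.IH(1)[unfolded subst_fm.simps] ImpE.IH(2)] .
next
  case (Classical p G)
  have "insert (\<^bold>\<not> subst_fm s r p) (subst_fm s r ` G) \<turnstile> Falsum"
    using Classical.IH[of s r] by (simp add: Neg_def)
  then show ?case by (rule derives.Classical)
next
  case (AllN_I G p)
  let ?s = "case_nat (Var 0) (\<lambda>i. lift_trm_N (s i))"
  have "subst_fm ?s r ` lift_N ` G = lift_N ` subst_fm s r ` G"
    by (simp add: image_image subst_fm_lift_N)
  then show ?case using AllN_I.IH[of ?s r] by (auto intro!: derives.AllN_I)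
next
  case (AllN_E G p t)
  then show ?case by (auto simp: subst_fm_inst_N intro!: derives.AllN_E)
next
  case (AllF_I a G p)
  let ?s = "\<lambda>i. lift_trm_F a (s i)" and ?r = "r(a := case_nat 0 (\<lambda>i. Suc (r a i)))"
  have "subst_fm ?s ?r ` lift_F a ` G = lift_F a ` subst_fm s r ` G"
    by (simp add: image_image subst_fm_lift_F)
  then have "lift_F a ` subst_fm s r ` G \<turnstile> subst_fm ?s ?r p"
    using AllF_I.IH[of ?s ?r] by (simp only:)
  then show ?case by (simp only: subst_fm.simps derives.AllF_I)
next
  case (AllF_E G a p f)
  then show ?case by (auto simp: subst_fm_inst_F intro!: derives.AllF_E)
next
  case (Leibniz G t u p)
  show ?case
    using derives.Leibniz[OF Leibniz.IH(1)[unfolded subst_fm.simps]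
        Leibniz.IH(2)[unfolded subst_fm_inst_N]]
    by (simp add: subst_fm_inst_N)
qed (auto intro: derives.intros)

text \<open>Each rule uses finitely many hypotheses; for the quantifier introduction rules, a finite
  set of lifted hypotheses is the image of a finite set of hypotheses.\<close>

lemma derives_finite: "G \<turnstile> p \<Longrightarrow> \<exists>H. finite H \<and> H \<subseteq> G \<and> H \<turnstile> p"
proof (induction rule: derives.induct)
  case (Assm p G)
  then show ?case by (intro exI[of _ "{p}"]) (auto intro: derives.Assm)
next
  case (ImpI p G q)
  then obtain H where H: "finite H" "H \<subseteq> insert p G" "H \<turnstile> q" by auto
  have "H - {p} \<turnstile> p \<^bold>\<longrightarrow> q"
    by (rule derives.ImpI[OF derives_mono[OF H(3)]]) auto
  with H show ?case by (intro exI[of _ "H - {p}"]) auto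
next
  case (ImpE G p q)
  then obtain H H' where "finite H" "H \<subseteq> G" "H \<turnstile> p \<^bold>\<longrightarrow> q" "finite H'" "H' \<subseteq> G" "H' \<turnstile> p" by auto
  moreover from this have "H \<union> H' \<turnstile> q"
    by (meson derives.ImpE derives_mono Un_upper1 Un_upper2)
  ultimately show ?case by (intro exI[of _ "H \<union> H'"]) auto
next
  case (Classical p G)
  then obtain H where H: "finite H" "H \<subseteq> insert (\<^bold>\<not> p) G" "H \<turnstile> Falsum" by auto
  have "H - {\<^bold>\<not> p} \<turnstile> p"
    by (rule derives.Classical[OF derives_mono[OF H(3)]]) auto
  with H show ?case by (intro exI[of _ "H - {\<^bold>\<not> p}"]) auto
next
  case (AllN_I G p)
  then show ?case by (metis derives.AllN_I finite_subset_image)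
next
  case (AllF_I a G p)
  then show ?case by (metis derives.AllF_I finite_subset_image)
next
  case (Leibniz G t u p)
  then obtain H H' where "finite H" "H \<subseteq> G" "H \<turnstile> t \<^bold>= u" "finite H'" "H' \<subseteq> G" "H' \<turnstile> inst_N t p"
    by auto
  moreover from this have "H \<union> H' \<turnstile> inst_N u p"
    by (meson derives.Leibniz derives_mono Un_upper1 Un_upper2)
  ultimately show ?case by (intro exI[of _ "H \<union> H'"]) auto
next
  case (Refl G t)
  show ?case by (intro exI[of _ "{}"]) (auto intro: derives.Refl)
qed (metis derives.AllN_E derives.AllF_E)+

section \<open>Provable equality as a congruence\<close>

lemma derives_cong:
  assumes "G \<turnstile> t \<^bold>= u"
  shows "G \<turnstile> subst_trm (case_nat t Var) id_fun c \<^bold>= subst_trm (case_nat u Var) id_fun c"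
  \<comment> \<open>The left-hand side is lifted and so keeps \<open>t\<close> under both
    instantiations; at \<open>t\<close> the formula is an instance of reflexivity, at
    \<open>u\<close> it is the claim.\<close>
  using derives.Leibniz[OF assms, of "lift_trm_N (subst_trm (case_nat t Var) id_fun c) \<^bold>= c"]
  by (simp add: inst_N_def derives.Refl)

lemma derives_sym: "G \<turnstile> t \<^bold>= u \<Longrightarrow> G \<turnstile> u \<^bold>= t"
  using derives.Leibniz[of G t u "Var 0 \<^bold>= lift_trm_N t"] by (simp add: inst_N_def derives.Refl)

lemma derives_trans: "G \<turnstile> t \<^bold>= u \<Longrightarrow> G \<turnstile> u \<^bold>= v \<Longrightarrow> G \<turnstile> t \<^bold>= v"
  using derives.Leibniz[of G u v "lift_trm_N t \<^bold>= Var 0"] by (simp add: inst_N_def)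

lemma derives_Succ: "G \<turnstile> t \<^bold>= u \<Longrightarrow> G \<turnstile> Succ t \<^bold>= Succ u"
  using derives_cong[of G t u "Succ (Var 0)"] by simp

lemma derives_Ap1: "G \<turnstile> t \<^bold>= u \<Longrightarrow> G \<turnstile> Ap1 f t \<^bold>= Ap1 f u"
  using derives_cong[of G t u "Ap1 f (Var 0)"] by simp

lemma derives_Ap2: "G \<turnstile> t \<^bold>= u \<Longrightarrow> G \<turnstile> t' \<^bold>= u' \<Longrightarrow> G \<turnstile> Ap2 f t t' \<^bold>= Ap2 f u u'"
  using derives_cong[of G t u "Ap2 f (Var 0) (lift_trm_N t')"]
    derives_cong[of G t' u' "Ap2 f (lift_trm_N u) (Var 0)"]
  by (auto intro: derives_trans)

lemma derives_Ap3:
  "G \<turnstile> t \<^bold>= u \<Longrightarrow> G \<turnstile> t' \<^bold>= u' \<Longrightarrow> G \<turnstile> t'' \<^bold>= u'' \<Longrightarrow> G \<turnstile> Ap3 f t t' t'' \<^bold>= Ap3 f u u' u''"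
  using derives_cong[of G t u "Ap3 f (Var 0) (lift_trm_N t') (lift_trm_N t'')"]
    derives_cong[of G t' u' "Ap3 f (lift_trm_N u) (Var 0) (lift_trm_N t'')"]
    derives_cong[of G t'' u'' "Ap3 f (lift_trm_N u) (lift_trm_N u') (Var 0)"]
  by (auto intro: derives_trans)


section \<open>Fresh variables\<close>

text \<open>Serves to say that a formula has no free variable from \<open>K\<close> on:
  substitutions agreeing below \<open>K\<close> then give the same result. One bound covers all
  sorts, so index \<open>K\<close> is fresh in each of them.\<close>

definition agree :: "nat \<Rightarrow> (nat \<Rightarrow> trm) \<Rightarrow> (arity \<Rightarrow> nat \<Rightarrow> nat) \<Rightarrow>
    (nat \<Rightarrow> trm) \<Rightarrow> (arity \<Rightarrow> nat \<Rightarrow> nat) \<Rightarrow> bool" where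
  "agree K s r s' r' \<longleftrightarrow> (\<forall>i<K. s i = s' i \<and> (\<forall>a. r a i = r' a i))"

text \<open>All free variables, of all four sorts, have an index below \<open>K\<close>.\<close>

definition bounded_by :: "nat \<Rightarrow> fm \<Rightarrow> bool" where
  "bounded_by K p \<longleftrightarrow> (\<forall>s r s' r'. agree K s r s' r' \<longrightarrow> subst_fm s r p = subst_fm s' r' p)"

lemma agree_mono: "agree K s r s' r' \<Longrightarrow> L \<le> K \<Longrightarrow> agree L s r s' r'"
  by (auto simp: agree_def)

lemma bounded_by_mono: "bounded_by K p \<Longrightarrow> K \<le> L \<Longrightarrow> bounded_by L p"
  by (meson agree_mono bounded_by_def)

lemma subst_trm_bounded:
  "\<exists>K. \<forall>s r s' r'. agree K s r s' r' \<longrightarrow> subst_trm s r t = subst_trm s' r' t"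
proof (induction t)
  case (Var i)
  show ?case by (rule exI[of _ "Suc i"]) (auto simp: agree_def)
next
  case (Ap1 f t)
  then obtain K where "\<forall>s r s' r'. agree K s r s' r' \<longrightarrow> subst_trm s r t = subst_trm s' r' t" ..
  then show ?case
    by (intro exI[of _ "K + Suc f"]) (fastforce simp: agree_def)
next
  case (Ap2 f t u)
  then obtain K L where "\<forall>s r s' r'. agree K s r s' r' \<longrightarrow> subst_trm s r t = subst_trm s' r' t"
    "\<forall>s r s' r'. agree L s r s' r' \<longrightarrow> subst_trm s r u = subst_trm s' r' u" by blast
  then show ?case
    by (intro exI[of _ "K + L + Suc f"]) (simp add: agree_def)
next
  case (Ap3 f t u v)
  then obtain K L M where "\<forall>s r s' r'. agree K s r s' r' \<longrightarrow> subst_trm s r t = subst_trm s' r' t"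
    "\<forall>s r s' r'. agree L s r s' r' \<longrightarrow> subst_trm s r u = subst_trm s' r' u"
    "\<forall>s r s' r'. agree M s r s' r' \<longrightarrow> subst_trm s r v = subst_trm s' r' v" by blast
  then show ?case
    by (intro exI[of _ "K + L + M + Suc f"]) (simp add: agree_def)
qed auto

lemma ex_bounded_by: "\<exists>K. bounded_by K p"
proof (induction p)
  case (Eq t u)
  obtain K L where "\<forall>s r s' r'. agree K s r s' r' \<longrightarrow> subst_trm s r t = subst_trm s' r' t"
    "\<forall>s r s' r'. agree L s r s' r' \<longrightarrow> subst_trm s r u = subst_trm s' r' u"
    using subst_trm_bounded by meson
  then show ?case
    by (intro exI[of _ "K + L"]) (simp add: agree_def bounded_by_def)
next
  case (Imp p q)
  then obtain K L where "bounded_by K p" "bounded_by L q" by blast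
  then have "bounded_by (K + L) p" "bounded_by (K + L) q"
    by (auto elim: bounded_by_mono)
  then have "bounded_by (K + L) (p \<^bold>\<longrightarrow> q)"
    unfolding bounded_by_def subst_fm.simps by metis
  then show ?case ..
next
  case (AllN p)
  then obtain K where "bounded_by K p" ..
  then have "bounded_by K (AllN p)"
    unfolding bounded_by_def subst_fm.simps
    by (auto simp: agree_def split: nat.split)
  then show ?case ..
next
  case (AllF a p)
  then obtain K where "bounded_by K p" ..
  then have "bounded_by K (AllF a p)"
    unfolding bounded_by_def subst_fm.simps
    by (auto simp: agree_def split: nat.split)
  then show ?case ..
qed (auto simp: bounded_by_def)

lemma ex_bounded_by_set: "finite G \<Longrightarrow> \<exists>K. \<forall>p\<in>G. bounded_by K p"
proof (induction rule: finite_induct)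
  case (insert q G)
  then obtain K L where "\<forall>p\<in>G. bounded_by K p" "bounded_by L q" using ex_bounded_by by blast
  then have "\<forall>p\<in>insert q G. bounded_by (K + L) p"
    using bounded_by_mono le_add1 le_add2 by blast
  then show ?case ..
qed auto

lemma derives_AllN_fresh:
  assumes "\<forall>p\<in>G. bounded_by K p" and "bounded_by K q" and "G \<turnstile> inst_N (Var K) q"
  shows "G \<turnstile> AllN q"
proof -
  \<comment> \<open>On formulas bounded by \<open>K\<close> this renaming acts as lifting, while it
    carries the fresh variable \<open>K\<close> back to the bound index 0.\<close>
  define s where "s i = (if i = K then Var 0 else Var (Suc i))" for i
  have "subst_fm s id_fun p = lift_N p" if "p \<in> G" for p
    using assms(1) that unfolding bounded_by_def lift_N_def by (auto simp: agree_def s_def)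
  then have "subst_fm s id_fun ` G = lift_N ` G" by auto
  moreover have "subst_fm s id_fun (inst_N (Var K) q) = subst_fm Var id_fun q"
    unfolding inst_N_def subst_fm_subst_fm
    by (rule assms(2)[unfolded bounded_by_def, rule_format])
      (auto simp: agree_def s_def split: nat.split)
  ultimately show ?thesis
    using derives_subst[OF assms(3), of s id_fun]
    by (auto simp: subst_fm_id intro: derives.AllN_I)
qed

lemma derives_AllF_fresh:
  assumes "\<forall>p\<in>G. bounded_by K p" and "bounded_by K q" and "G \<turnstile> inst_F a K q"
  shows "G \<turnstile> AllF a q"
proof -
  define r where "r = id_fun(a := (\<lambda>i. if i = K then 0 else Suc i))"
  have "subst_fm Var r p = lift_F a p" if "p \<in> G" for p
    using assms(1) that unfolding bounded_by_def lift_F_def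
    by (auto simp: agree_def r_def suc_fun_def)
  then have "subst_fm Var r ` G = lift_F a ` G" by auto
  moreover have "subst_fm Var r (inst_F a K q) = subst_fm Var id_fun q"
    unfolding inst_F_def subst_fm_subst_fm
    by (rule assms(2)[unfolded bounded_by_def, rule_format])
      (auto simp: agree_def r_def split: nat.split)
  ultimately show ?thesis
    using derives_subst[OF assms(3), of Var r]
    by (auto simp: subst_fm_id intro: derives.AllF_I)
qed


section \<open>Completeness\<close>

instance arity :: countable by countable_datatype
instance trm :: countable by countable_datatype
instance fm :: countable by countable_datatype

section \<open>Maximal consistent sets with witnesses\<close>

definition consistent :: "fm set \<Rightarrow> bool" where
  "consistent G \<longleftrightarrow> \<not> G \<turnstile> Falsum"

lemma derives_contradiction: "G \<turnstile> p \<Longrightarrow> G \<turnstile> \<^bold>\<not> p \<Longrightarrow> G \<turnstile> Falsum"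
  unfolding Neg_def by (rule derives.ImpE)

lemma consistent_cases:
  assumes "consistent G"
  shows "consistent (insert p G) \<or> consistent (insert (\<^bold>\<not> p) G)"
  using assms unfolding consistent_def
  by (metis Neg_def derives.Classical derives.ImpE derives.ImpI)

text \<open>A finite set leaves some variable fresh. If the negated instance at this variable were
  inconsistent with \<open>G\<close>, then the instance, and by freshness the universal formula,
  would be derivable from \<open>G\<close>.\<close>

lemma consistent_witness_N:
  assumes "finite G" "consistent G" "\<^bold>\<not> AllN q \<in> G"
  shows "\<exists>t. consistent (insert (\<^bold>\<not> inst_N t q) G)"
proof -
  obtain K where K: "\<forall>p\<in>insert q G. bounded_by K p"
    using ex_bounded_by_set[of "insert q G"] assms(1) by auto
  have "consistent (insert (\<^bold>\<not> inst_N (Var K) q) G)"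
  proof (rule ccontr)
    assume "\<not> consistent (insert (\<^bold>\<not> inst_N (Var K) q) G)"
    then have "G \<turnstile> AllN q"
      using K by (auto simp: consistent_def intro: derives.Classical derives_AllN_fresh)
    then show False
      using assms(2,3) derives_contradiction derives.Assm unfolding consistent_def by blast
  qed
  then show ?thesis ..
qed

lemma consistent_witness_F:
  assumes "finite G" "consistent G" "\<^bold>\<not> AllF a q \<in> G"
  shows "\<exists>f. consistent (insert (\<^bold>\<not> inst_F a f q) G)"
proof -
  obtain K where K: "\<forall>p\<in>insert q G. bounded_by K p"
    using ex_bounded_by_set[of "insert q G"] assms(1) by auto
  have "consistent (insert (\<^bold>\<not> inst_F a K q) G)"
  proof (rule ccontr)
    assume "\<not> consistent (insert (\<^bold>\<not> inst_F a K q) G)"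
    then have "G \<turnstile> AllF a q"
      using K by (auto simp: consistent_def intro: derives.Classical derives_AllF_fresh)
    then show False
      using assms(2,3) derives_contradiction derives.Assm unfolding consistent_def by blast
  qed
  then show ?thesis ..
qed

text \<open>Joins maximality at \<open>p\<close> with the Henkin condition at \<open>p\<close>, so
  that one pass through an enumeration of the formulas secures both.\<close>

definition settles :: "fm set \<Rightarrow> fm \<Rightarrow> bool" where
  "settles G p \<longleftrightarrow> (p \<in> G \<or> \<^bold>\<not> p \<in> G) \<and>
     (\<forall>q. p = \<^bold>\<not> AllN q \<longrightarrow> p \<in> G \<longrightarrow> (\<exists>t. \<^bold>\<not> inst_N t q \<in> G)) \<and>
     (\<forall>a q. p = \<^bold>\<not> AllF a q \<longrightarrow> p \<in> G \<longrightarrow> (\<exists>f. \<^bold>\<not> inst_F a f q \<in> G))"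

lemma ex_settles:
  assumes "finite G" "consistent G"
  shows "\<exists>H. G \<subseteq> H \<and> finite H \<and> consistent H \<and> settles H p"
proof (cases "consistent (insert p G)")
  case True
  have fin: "finite (insert p G)" using assms(1) by simp
  consider q where "p = \<^bold>\<not> AllN q" | a q where "p = \<^bold>\<not> AllF a q"
    | "\<nexists>q. p = \<^bold>\<not> AllN q" "\<nexists>a q. p = \<^bold>\<not> AllF a q" by blast
  then show ?thesis
  proof cases
    case 1
    then obtain t where "consistent (insert (\<^bold>\<not> inst_N t q) (insert p G))"
      using consistent_witness_N[OF fin True] by blast
    then show ?thesis using 1 fin
      by (intro exI[of _ "insert (\<^bold>\<not> inst_N t q) (insert p G)"]) (auto simp: settles_def Neg_def)
  next
    case 2
    then obtain f where "consistent (insert (\<^bold>\<not> inst_F a f q) (insert p G))"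
      using consistent_witness_F[OF fin True] by blast
    then show ?thesis using 2 fin
      by (intro exI[of _ "insert (\<^bold>\<not> inst_F a f q) (insert p G)"]) (auto simp: settles_def Neg_def)
  next
    case 3
    then show ?thesis using True fin
      by (intro exI[of _ "insert p G"]) (auto simp: settles_def)
  qed
next
  case False
  then have "consistent (insert (\<^bold>\<not> p) G)" using consistent_cases[OF assms(2)] by blast
  \<comment> \<open>Since \<open>p\<close> is absent, the witness conditions for \<open>p\<close>
    hold vacuously.\<close>
  moreover from this have "p \<notin> insert (\<^bold>\<not> p) G"
    using derives_contradiction derives.Assm unfolding consistent_def by blast
  ultimately show ?thesis using assms(1)
    by (intro exI[of _ "insert (\<^bold>\<not> p) G"]) (auto simp: settles_def)
qed

text \<open>Lindenbaum's construction with Henkin witnesses: stage \<open>n\<close> settles the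
  formula with code \<open>n\<close>. Every stage stays finite, so fresh variables never run
  out.\<close>

lemma settles_all:
  assumes "finite G" "consistent G"
  shows "\<exists>U. G \<subseteq> U \<and> consistent U \<and> (\<forall>p. settles U p)"
proof -
  have "\<exists>X. \<forall>n. (finite (X n) \<and> consistent (X n) \<and> G \<subseteq> X n) \<and>
      (X n \<subseteq> X (Suc n) \<and> settles (X (Suc n)) (from_nat n))"
  proof (rule dependent_nat_choice)
    fix H n assume "finite H \<and> consistent H \<and> G \<subseteq> H"
    then show "\<exists>H'. (finite H' \<and> consistent H' \<and> G \<subseteq> H') \<and>
        (H \<subseteq> H' \<and> settles H' (from_nat n))"
      using ex_settles[of H "from_nat n"] by blast
  qed (use assms in auto)
  then obtain X :: "nat \<Rightarrow> fm set" where X: "\<And>n. consistent (X n)" "\<And>n. G \<subseteq> X n"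
    "\<And>n. X n \<subseteq> X (Suc n)" "\<And>n. settles (X (Suc n)) (from_nat n)" by blast
  have mono: "X m \<subseteq> X n" if "m \<le> n" for m n using X(3) that by (rule lift_Suc_mono_le)
  have con: "consistent (\<Union>n. X n)"
  proof (rule ccontr)
    assume "\<not> consistent (\<Union>n. X n)"
    then obtain H where H: "finite H" "H \<subseteq> (\<Union>n. X n)" "H \<turnstile> Falsum"
      using derives_finite unfolding consistent_def by blast
    from H(1,2) have "\<exists>n. H \<subseteq> X n"
    proof (induction rule: finite_induct)
      case (insert p H)
      then obtain m n where "H \<subseteq> X m" "p \<in> X n" by auto
      then have "insert p H \<subseteq> X (max m n)"
        using mono[of m "max m n"] mono[of n "max m n"] by auto
      then show ?case ..
    qed auto
    then show False using H(3) X(1) derives_mono unfolding consistent_def by blast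
  qed
  have "settles (\<Union>n. X n) p" for p
  proof -
    have p: "settles (X (Suc (to_nat p))) p" using X(4)[of "to_nat p"] by simp
    \<comment> \<open>The witness conditions speak of membership and do not pass automatically to
      larger sets. A formula of the union must already lie in its own stage, since otherwise its
      negation does and the union is inconsistent.\<close>
    have "p \<in> X (Suc (to_nat p))" if "p \<in> (\<Union>n. X n)"
    proof (rule ccontr)
      assume "p \<notin> X (Suc (to_nat p))"
      then have "\<^bold>\<not> p \<in> (\<Union>n. X n)" using p unfolding settles_def by blast
      then show False
        using con that derives_contradiction derives.Assm unfolding consistent_def by blast
    qed
    then show ?thesis using p unfolding settles_def by blast
  qed
  then show ?thesis using X(2) con by blast
qed

section \<open>Truth in general structures\<close>

locale interp =
  fixes zero :: 'a and suc :: "'a \<Rightarrow> 'a"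
    and F1 :: "('a \<Rightarrow> 'a) set" and F2 :: "('a \<Rightarrow> 'a \<Rightarrow> 'a) set"
    and F3 :: "('a \<Rightarrow> 'a \<Rightarrow> 'a \<Rightarrow> 'a) set"
begin

primrec trm_val :: "(nat \<Rightarrow> 'a) \<Rightarrow> (nat \<Rightarrow> 'a \<Rightarrow> 'a) \<Rightarrow> (nat \<Rightarrow> 'a \<Rightarrow> 'a \<Rightarrow> 'a) \<Rightarrow>
    (nat \<Rightarrow> 'a \<Rightarrow> 'a \<Rightarrow> 'a \<Rightarrow> 'a) \<Rightarrow> trm \<Rightarrow> 'a" where
  "trm_val e f g h (Var i) = e i"
| "trm_val e f g h Zero = zero"
| "trm_val e f g h (Succ t) = suc (trm_val e f g h t)"
| "trm_val e f g h (Ap1 i t) = f i (trm_val e f g h t)"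
| "trm_val e f g h (Ap2 i t u) = g i (trm_val e f g h t) (trm_val e f g h u)"
| "trm_val e f g h (Ap3 i t u v) =
     h i (trm_val e f g h t) (trm_val e f g h u) (trm_val e f g h v)"

primrec sat :: "(nat \<Rightarrow> 'a) \<Rightarrow> (nat \<Rightarrow> 'a \<Rightarrow> 'a) \<Rightarrow> (nat \<Rightarrow> 'a \<Rightarrow> 'a \<Rightarrow> 'a) \<Rightarrow>
    (nat \<Rightarrow> 'a \<Rightarrow> 'a \<Rightarrow> 'a \<Rightarrow> 'a) \<Rightarrow> fm \<Rightarrow> bool" where
  "sat e f g h Falsum \<longleftrightarrow> False"
| "sat e f g h (t \<^bold>= u) \<longleftrightarrow> trm_val e f g h t = trm_val e f g h u"
| "sat e f g h (p \<^bold>\<longrightarrow> q) \<longleftrightarrow> (sat e f g h p \<longrightarrow> sat e f g h q)"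
| "sat e f g h (AllN p) \<longleftrightarrow> (\<forall>x. sat (case_nat x e) f g h p)"
| "sat e f g h (AllF a p) \<longleftrightarrow>
     (case a of
        Una \<Rightarrow> \<forall>\<phi>\<in>F1. sat e (case_nat \<phi> f) g h p
      | Bin \<Rightarrow> \<forall>\<phi>\<in>F2. sat e f (case_nat \<phi> g) h p
      | Ter \<Rightarrow> \<forall>\<phi>\<in>F3. sat e f g (case_nat \<phi> h) p)"

end

text \<open>
  The successor axioms make the term model infinite, so that its countably many elements can be
  identified with \<open>nat\<close> (of which only the cardinality is used).
\<close>

lemma completeness:
  assumes "finite G" and succ_ax: "successor_axioms \<subseteq> G"
    and valid: "\<And>zero suc F1 F2 F3 e f g h.
      \<forall>q\<in>G. interp.sat zero suc F1 F2 F3 (e :: nat \<Rightarrow> nat) f g h q \<Longrightarrow>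
      interp.sat zero suc F1 F2 F3 e f g h p"
  shows "G \<turnstile> p"
proof (rule ccontr)
  assume "\<not> G \<turnstile> p"
  then have "consistent (insert (\<^bold>\<not> p) G)"
    unfolding consistent_def using derives.Classical by blast
  then obtain U where U: "insert (\<^bold>\<not> p) G \<subseteq> U" "consistent U" "\<And>q. settles U q"
    using settles_all[of "insert (\<^bold>\<not> p) G"] assms(1) by auto
  have Neg: "\<^bold>\<not> q \<in> U \<longleftrightarrow> q \<notin> U" for q
    using U(2) U(3)[of q] derives_contradiction derives.Assm
    unfolding consistent_def settles_def by blast
  have mem: "q \<in> U" if "U \<turnstile> q" for q
    using that U(2) Neg derives_contradiction derives.Assm unfolding consistent_def by blast
  have Falsum: "Falsum \<notin> U"
    using U(2) derives.Assm unfolding consistent_def by blast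
  have Imp: "(q \<^bold>\<longrightarrow> q') \<in> U \<longleftrightarrow> (q \<in> U \<longrightarrow> q' \<in> U)" for q q'
  proof
    assume "(q \<^bold>\<longrightarrow> q') \<in> U"
    then show "q \<in> U \<longrightarrow> q' \<in> U" using mem derives.ImpE derives.Assm by blast
  next
    assume *: "q \<in> U \<longrightarrow> q' \<in> U"
    show "(q \<^bold>\<longrightarrow> q') \<in> U"
    proof (cases "q \<in> U")
      case True
      then have "insert q U \<turnstile> q'" using * by (auto intro: derives.Assm)
      then show ?thesis using mem derives.ImpI by blast
    next
      case False
      then have "insert (\<^bold>\<not> q') (insert q U) \<turnstile> Falsum"
        using Neg by (auto intro: derives_contradiction derives.Assm)
      then show ?thesis using mem derives.ImpI derives.Classical by blast
    qed
  qed
  have AllN_iff: "AllN q \<in> U \<longleftrightarrow> (\<forall>t. inst_N t q \<in> U)" for q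
  proof
    assume "AllN q \<in> U"
    then show "\<forall>t. inst_N t q \<in> U" using mem derives.AllN_E derives.Assm by blast
  next
    assume "\<forall>t. inst_N t q \<in> U"
    then show "AllN q \<in> U" using U(3)[of "\<^bold>\<not> AllN q"] Neg unfolding settles_def by blast
  qed
  have AllF_iff: "AllF a q \<in> U \<longleftrightarrow> (\<forall>f. inst_F a f q \<in> U)" for a q
  proof
    assume "AllF a q \<in> U"
    then show "\<forall>f. inst_F a f q \<in> U" using mem derives.AllF_E derives.Assm by blast
  next
    assume "\<forall>f. inst_F a f q \<in> U"
    then show "AllF a q \<in> U" using U(3)[of "\<^bold>\<not> AllF a q"] Neg unfolding settles_def by blast
  qed

  \<comment> \<open>The model consists of the terms modulo equality in \<open>U\<close>.\<close>
  define cls where "cls t = {u. (t \<^bold>= u) \<in> U}" for t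
  have cls_eq: "cls t = cls u \<longleftrightarrow> (t \<^bold>= u) \<in> U" for t u
    unfolding cls_def
    using mem[OF derives.Refl] mem[OF derives_sym] mem[OF derives_trans] derives.Assm by blast
  have Succ_Zero: "cls (Succ t) \<noteq> cls Zero" for t
  proof -
    have "AllN (\<^bold>\<not> (Succ (Var 0) \<^bold>= Zero)) \<in> U"
      using U(1) succ_ax by (auto simp: successor_axioms_def)
    then have "inst_N t (\<^bold>\<not> (Succ (Var 0) \<^bold>= Zero)) \<in> U"
      by (simp only: AllN_iff)
    then show ?thesis using Imp Falsum by (simp add: cls_eq inst_N_def Neg_def)
  qed
  have Succ_inj: "cls t = cls u" if "cls (Succ t) = cls (Succ u)" for t u
  proof -
    have "AllN (AllN (Succ (Var 1) \<^bold>= Succ (Var 0) \<^bold>\<longrightarrow> Var 1 \<^bold>= Var 0)) \<in> U"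
      using U(1) succ_ax by (auto simp: successor_axioms_def)
    \<comment> \<open>The double instance, with \<open>t\<close> for the outer and \<open>u\<close>
      for the inner variable, in the form that \<open>inst_N_subst_fm\<close> collapses to a single
      substitution.\<close>
    then have "inst_N u (subst_fm (case_nat (Var 0) (\<lambda>i. lift_trm_N (case_nat t Var i))) id_fun
        (Succ (Var 1) \<^bold>= Succ (Var 0) \<^bold>\<longrightarrow> Var 1 \<^bold>= Var 0)) \<in> U"
      by (simp add: AllN_iff inst_N_def)
    then show ?thesis using Imp that unfolding inst_N_subst_fm by (simp add: cls_eq)
  qed
  have cls_numeral: "cls ((Succ ^^ i) Zero) = cls ((Succ ^^ j) Zero) \<Longrightarrow> i = j" for i j
  proof (induction i arbitrary: j)
    case 0
    then show ?case
      using not_sym[OF Succ_Zero] by (cases j) (simp_all only: funpow.simps comp_apply id_apply)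
  next
    case (Suc i)
    show ?case
    proof (cases j)
      case 0
      then show ?thesis
        using Suc.prems Succ_Zero by (simp only: funpow.simps comp_apply id_apply)
    next
      case j: (Suc k)
      have "cls ((Succ ^^ i) Zero) = cls ((Succ ^^ k) Zero)"
        using Suc.prems unfolding j funpow.simps comp_apply by (rule Succ_inj)
      then show ?thesis using Suc.IH j by simp
    qed
  qed
  have "inj (\<lambda>i. cls ((Succ ^^ i) Zero))" using cls_numeral by (auto intro!: injI)
  then have inf: "infinite (range cls)"
    by (metis finite_subset image_subset_iff infinite_UNIV_char_0 finite_imageD rangeI)
  define val where "val t = to_nat_on (range cls) (cls t)" for t
  have bij: "bij_betw (to_nat_on (range cls)) (range cls) UNIV"
    using inf by (intro to_nat_on_infinite) auto
  have val_eq: "val t = val u \<longleftrightarrow> (t \<^bold>= u) \<in> U" for t u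
    unfolding val_def cls_eq[symmetric]
    by (rule inj_on_eq_iff[OF bij_betw_imp_inj_on[OF bij]]) auto
  have surj: "surj val"
    using bij_betw_imp_surj_on[OF bij] by (simp add: val_def image_image)
  \<comment> \<open>The operations on values are defined through representing terms; the congruence
    rules make them independent of the choice.\<close>
  define rep where "rep = inv val"
  have val_rep [simp]: "val (rep x) = x" for x
    using surj unfolding rep_def by (rule surj_f_inv_f)
  have rep_val: "U \<turnstile> rep (val t) \<^bold>= t" for t
    using val_rep[of "val t"] val_eq by (blast intro: derives.Assm)
  define suc where "suc x = val (Succ (rep x))" for x
  define f where "f i x = val (Ap1 i (rep x))" for i x
  define g where "g i x y = val (Ap2 i (rep x) (rep y))" for i x y
  define h where "h i x y w = val (Ap3 i (rep x) (rep y) (rep w))" for i x y w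
  have val_Succ: "suc (val t) = val (Succ t)" for t
    unfolding suc_def val_eq by (intro mem derives_Succ rep_val)
  have val_Ap1: "f i (val t) = val (Ap1 i t)" for i t
    unfolding f_def val_eq by (intro mem derives_Ap1 rep_val)
  have val_Ap2: "g i (val t) (val u) = val (Ap2 i t u)" for i t u
    unfolding g_def val_eq by (intro mem derives_Ap2 rep_val)
  have val_Ap3: "h i (val t) (val u) (val v) = val (Ap3 i t u v)" for i t u v
    unfolding h_def val_eq by (intro mem derives_Ap3 rep_val)
  \<comment> \<open>The function quantifiers range over exactly the functions named by variables,
    matching the witnesses in \<open>U\<close>, which are variables too.\<close>
  interpret interp "val Zero" suc "range f" "range g" "range h" .
  have trm: "trm_val (\<lambda>i. val (s i)) (\<lambda>i. f (r Una i)) (\<lambda>i. g (r Bin i)) (\<lambda>i. h (r Ter i)) t =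
      val (subst_trm s r t)" for s r t
    by (induction t) (simp_all add: val_Succ val_Ap1 val_Ap2 val_Ap3)
  \<comment> \<open>Stated for all substitutions, so that the induction can pass below a quantifier
    by extending the substitution with the instantiating term or function variable.\<close>
  have truth: "sat (\<lambda>i. val (s i)) (\<lambda>i. f (r Una i)) (\<lambda>i. g (r Bin i)) (\<lambda>i. h (r Ter i)) q \<longleftrightarrow>
      subst_fm s r q \<in> U" for s r q
  proof (induction q arbitrary: s r)
    case (AllN q)
    have env: "case_nat (val t) (\<lambda>i. val (s i)) = (\<lambda>i. val (case_nat t s i))" for t
      by (auto split: nat.split)
    have all: "(\<forall>x. P x) \<longleftrightarrow> (\<forall>t. P (val t))" for P
      by (metis val_rep)
    show ?case
      unfolding sat.simps subst_fm.simps AllN_iff inst_N_subst_fm all env AllN.IH ..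
  next
    case (AllF a q)
    have env: "case_nat (k j) (\<lambda>i. k (r' i)) = (\<lambda>i. k (case_nat j r' i))"
      for j and r' :: "nat \<Rightarrow> nat" and k :: "nat \<Rightarrow> 'b"
      by (auto split: nat.split)
    show ?case
      unfolding sat.simps subst_fm.simps AllF_iff inst_F_subst_fm AllF.IH[symmetric]
      by (cases a) (simp_all add: env)
  qed (simp_all add: trm val_eq Falsum Imp)
  have "sat (\<lambda>i. val (Var i)) f g h q \<longleftrightarrow> q \<in> U" for q
    using truth[of Var id_fun q] by (simp add: subst_fm_id)
  then show False
    using valid[of "val Zero" suc "range f" "range g" "range h" "\<lambda>i. val (Var i)" f g h]
      U(1) Neg by blast
qed


section \<open>Arithmetic in a model\<close>

text \<open>The axioms read in a structure. Induction covers only equations between members of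
  \<open>F1\<close>, so every inductive claim below has to be brought into that form, with both
  sides shown to lie in \<open>F1\<close>.\<close>

locale pra_model =
  fixes zero :: 'a  (\<open>\<zero>\<close>) and suc :: "'a \<Rightarrow> 'a"
    and F1 :: "('a \<Rightarrow> 'a) set" and F2 :: "('a \<Rightarrow> 'a \<Rightarrow> 'a) set"
    and F3 :: "('a \<Rightarrow> 'a \<Rightarrow> 'a \<Rightarrow> 'a) set"
  assumes suc_neq_zero [simp]: "suc n \<noteq> \<zero>"
    and suc_inj [simp]: "suc n = suc m \<longleftrightarrow> n = m"
    and suc_cases: "n \<noteq> \<zero> \<Longrightarrow> \<exists>m. suc m = n"
    and ex_const: "\<exists>f\<in>F1. \<forall>m. f m = n"
    and ex_proj1: "\<exists>f\<in>F3. \<forall>m n r. f m n r = m"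
    and ex_proj2: "\<exists>f\<in>F3. \<forall>m n r. f m n r = n"
    and ex_proj3: "\<exists>f\<in>F3. \<forall>m n r. f m n r = r"
    and ex_suc: "\<exists>f\<in>F1. \<forall>n. f n = suc n"
    and ex_lift2: "g2 \<in> F2 \<Longrightarrow> \<exists>f\<in>F3. \<forall>m n r. f m n r = g2 m n"
    and ex_lift1: "g1 \<in> F1 \<Longrightarrow> \<exists>f\<in>F3. \<forall>m n r. f m n r = g1 m"
    and ex_fix2: "g \<in> F3 \<Longrightarrow> \<exists>f\<in>F2. \<forall>m n. f m n = g m n r"
    and ex_fix1: "g \<in> F3 \<Longrightarrow> \<exists>f\<in>F1. \<forall>m. f m = g m n r"
    and ex_comp: "g \<in> F3 \<Longrightarrow> a \<in> F3 \<Longrightarrow> b \<in> F3 \<Longrightarrow> c \<in> F3 \<Longrightarrow>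
      \<exists>f\<in>F3. \<forall>m n r. f m n r = g (a m n r) (b m n r) (c m n r)"
    and ex_prim_rec: "g1 \<in> F1 \<Longrightarrow> a \<in> F3 \<Longrightarrow>
      \<exists>f\<in>F2. \<forall>m. f m \<zero> = g1 m \<and> (\<forall>n. f m (suc n) = a m n (f m n))"
    and eq_induct: "f1 \<in> F1 \<Longrightarrow> g1 \<in> F1 \<Longrightarrow> f1 \<zero> = g1 \<zero> \<Longrightarrow>
      (\<And>n. f1 n = g1 n \<Longrightarrow> f1 (suc n) = g1 (suc n)) \<Longrightarrow> f1 n = g1 n"
begin

section \<open>Closure of the function classes under explicit definition\<close>

lemma proj_F3 [intro!, simp]:
  "(\<lambda>m n r. m) \<in> F3" "(\<lambda>m n r. n) \<in> F3" "(\<lambda>m n r. r) \<in> F3"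
  using ex_proj1 ex_proj2 ex_proj3 by (auto simp flip: fun_eq_iff)

lemma comp3: "g \<in> F3 \<Longrightarrow> a \<in> F3 \<Longrightarrow> b \<in> F3 \<Longrightarrow> c \<in> F3 \<Longrightarrow>
    (\<lambda>m n r. g (a m n r) (b m n r) (c m n r)) \<in> F3"
  using ex_comp[of g a b c] by (auto simp flip: fun_eq_iff)

lemma lift1: "g \<in> F1 \<Longrightarrow> (\<lambda>m n r. g m) \<in> F3"
  using ex_lift1[of g] by (auto simp flip: fun_eq_iff)

lemma lift2: "g \<in> F2 \<Longrightarrow> (\<lambda>m n r. g m n) \<in> F3"
  using ex_lift2[of g] by (auto simp flip: fun_eq_iff)

lemma comp1: "g \<in> F1 \<Longrightarrow> a \<in> F3 \<Longrightarrow> (\<lambda>m n r. g (a m n r)) \<in> F3"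
  using comp3[OF lift1, of g a a a] by simp

lemma comp2: "g \<in> F2 \<Longrightarrow> a \<in> F3 \<Longrightarrow> b \<in> F3 \<Longrightarrow> (\<lambda>m n r. g (a m n r) (b m n r)) \<in> F3"
  using comp3[OF lift2, of g a b b] by simp

text \<open>Membership is decided in \<open>F3\<close>, where the general composition axiom lives;
  functions of smaller arity enter with dummy arguments, which are fixed again here.\<close>

lemma F1_I: "(\<lambda>m n r. g m) \<in> F3 \<Longrightarrow> g \<in> F1"
  using ex_fix1[of "\<lambda>m n r. g m"] by (auto simp flip: fun_eq_iff)

lemma F2_I: "(\<lambda>m n r. g m n) \<in> F3 \<Longrightarrow> g \<in> F2"
  using ex_fix2[of "\<lambda>m n r. g m n"] by (auto simp flip: fun_eq_iff)

lemma const_F3 [intro!, simp]: "(\<lambda>m n r. c) \<in> F3"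
proof -
  obtain f where f: "f \<in> F1" "\<And>m. f m = c" using ex_const by blast
  then have "f = (\<lambda>m. c)" by auto
  then show ?thesis using lift1[OF f(1)] by simp
qed

lemma suc_F3 [intro!]: "a \<in> F3 \<Longrightarrow> (\<lambda>m n r. suc (a m n r)) \<in> F3"
proof -
  obtain f where f: "f \<in> F1" "\<And>m. f m = suc m" using ex_suc by blast
  then have "f = suc" by auto
  then show "a \<in> F3 \<Longrightarrow> (\<lambda>m n r. suc (a m n r)) \<in> F3" using comp1 f(1) by blast
qed

lemma zero_suc_cases [case_names zero suc]:
  obtains "n = \<zero>" | k where "n = suc k"
  using suc_cases by metis

text \<open>Names one solution of the recursion equations. The scheme yields binary functions, so
  unary recursions such as \<open>pred\<close> fix the parameter at zero.\<close>

definition prim_rec :: "('a \<Rightarrow> 'a) \<Rightarrow> ('a \<Rightarrow> 'a \<Rightarrow> 'a \<Rightarrow> 'a) \<Rightarrow> 'a \<Rightarrow> 'a \<Rightarrow> 'a" where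
  "prim_rec g h = (SOME f. f \<in> F2 \<and> (\<forall>m. f m \<zero> = g m \<and> (\<forall>n. f m (suc n) = h m n (f m n))))"

context
  fixes g h
  assumes g: "(\<lambda>m n r. g m) \<in> F3" and h: "h \<in> F3"
begin

lemma prim_rec:
  "prim_rec g h \<in> F2 \<and> (\<forall>m. prim_rec g h m \<zero> = g m \<and>
     (\<forall>n. prim_rec g h m (suc n) = h m n (prim_rec g h m n)))"
proof -
  have "\<exists>f. f \<in> F2 \<and> (\<forall>m. f m \<zero> = g m \<and> (\<forall>n. f m (suc n) = h m n (f m n)))"
    using ex_prim_rec[OF F1_I[OF g] h] by blast
  then show ?thesis unfolding prim_rec_def by (rule someI_ex)
qed

lemma prim_rec_F2: "prim_rec g h \<in> F2"
  and prim_rec_zero: "prim_rec g h m \<zero> = g m"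
  and prim_rec_suc: "prim_rec g h m (suc n) = h m n (prim_rec g h m n)"
  using prim_rec by auto

end

lemma prim_rec_F3:
  assumes "(\<lambda>m n r. g m) \<in> F3" "h \<in> F3" "a \<in> F3" "b \<in> F3"
  shows "(\<lambda>m n r. prim_rec g h (a m n r) (b m n r)) \<in> F3"
  by (rule comp2[OF prim_rec_F2]) (use assms in auto)

section \<open>Addition and truncated subtraction\<close>

definition pred :: "'a \<Rightarrow> 'a" where
  "pred = prim_rec (\<lambda>m. \<zero>) (\<lambda>m n r. n) \<zero>"

definition add :: "'a \<Rightarrow> 'a \<Rightarrow> 'a"  (infixl \<open>\<oplus>\<close> 65) where
  "add = prim_rec (\<lambda>m. m) (\<lambda>m n r. suc r)"

definition sub :: "'a \<Rightarrow> 'a \<Rightarrow> 'a"  (infixl \<open>\<ominus>\<close> 65) where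
  "sub = prim_rec (\<lambda>m. m) (\<lambda>m n r. pred r)"

lemma pred_simps [simp]: "pred \<zero> = \<zero>" "pred (suc n) = n"
  by (simp_all add: pred_def prim_rec_zero prim_rec_suc)

lemma pred_F3 [intro!]: "a \<in> F3 \<Longrightarrow> (\<lambda>m n r. pred (a m n r)) \<in> F3"
  unfolding pred_def by (auto intro!: prim_rec_F3)

lemma add_simps [simp]: "m \<oplus> \<zero> = m" "m \<oplus> suc n = suc (m \<oplus> n)"
  by (simp_all add: add_def prim_rec_zero prim_rec_suc suc_F3)

lemma add_F2: "add \<in> F2"
  unfolding add_def by (auto intro!: prim_rec_F2)

lemma add_F3 [intro!]: "a \<in> F3 \<Longrightarrow> b \<in> F3 \<Longrightarrow> (\<lambda>m n r. a m n r \<oplus> b m n r) \<in> F3"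
  by (rule comp2[OF add_F2])

lemma sub_simps [simp]: "m \<ominus> \<zero> = m" "m \<ominus> suc n = pred (m \<ominus> n)"
  by (simp_all add: sub_def prim_rec_zero prim_rec_suc pred_F3)

lemma sub_F3 [intro!]: "a \<in> F3 \<Longrightarrow> b \<in> F3 \<Longrightarrow> (\<lambda>m n r. a m n r \<ominus> b m n r) \<in> F3"
  unfolding sub_def by (auto intro!: prim_rec_F3)

lemma zero_add [simp]: "\<zero> \<oplus> n = n"
  by (rule eq_induct[of "\<lambda>n. \<zero> \<oplus> n" "\<lambda>n. n"]) (auto intro!: F1_I)

lemma zero_sub [simp]: "\<zero> \<ominus> n = \<zero>"
  by (rule eq_induct[of "\<lambda>n. \<zero> \<ominus> n" "\<lambda>n. \<zero>"]) (auto intro!: F1_I)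

text \<open>
  Primitive recursion carries a single parameter, so a case distinction is the sum of two
  functions, one of which vanishes.
\<close>

lemma if_zero_F3:
  assumes "a \<in> F3" "b \<in> F3" "c \<in> F3"
  shows "(\<lambda>m n r. if c m n r = \<zero> then a m n r else b m n r) \<in> F3"
proof -
  define p where "p = prim_rec (\<lambda>m. m) (\<lambda>m n r. \<zero>)"
  define q where "q = prim_rec (\<lambda>m. \<zero>) (\<lambda>m n r. m)"
  have pq: "p \<in> F2" "q \<in> F2"
    unfolding p_def q_def by (auto intro!: prim_rec_F2)
  have p: "p m n = (if n = \<zero> then m else \<zero>)" for m n
    by (cases n rule: zero_suc_cases) (simp_all add: p_def prim_rec_zero prim_rec_suc)
  have q: "q m n = (if n = \<zero> then \<zero> else m)" for m n
    by (cases n rule: zero_suc_cases) (simp_all add: q_def prim_rec_zero prim_rec_suc)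
  have "(\<lambda>m n r. p (a m n r) (c m n r) \<oplus> q (b m n r) (c m n r)) \<in> F3"
    by (intro add_F3 comp2[OF pq(1)] comp2[OF pq(2)] assms)
  moreover have "(\<lambda>m n r. p (a m n r) (c m n r) \<oplus> q (b m n r) (c m n r)) =
      (\<lambda>m n r. if c m n r = \<zero> then a m n r else b m n r)"
    by (auto simp: p q fun_eq_iff)
  ultimately show ?thesis by simp
qed

lemma suc_sub_suc: "suc x \<ominus> suc y = x \<ominus> y"
  by (rule eq_induct[of "\<lambda>y. suc x \<ominus> suc y" "\<lambda>y. x \<ominus> y"]) (auto intro!: F1_I)

lemma pred_suc_sub: "pred (suc x \<ominus> y) = x \<ominus> y"
  using suc_sub_suc by simp

lemma sub_self [simp]: "x \<ominus> x = \<zero>"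
  by (rule eq_induct[of "\<lambda>x. x \<ominus> x" "\<lambda>x. \<zero>"])
    (auto intro!: F1_I simp: suc_sub_suc simp del: sub_simps(2))

lemma suc_sub_self [simp]: "suc x \<ominus> x = suc \<zero>"
  by (rule eq_induct[of "\<lambda>x. suc x \<ominus> x" "\<lambda>x. suc \<zero>"])
    (auto intro!: F1_I simp: suc_sub_suc simp del: sub_simps(2))

lemma suc_add [simp]: "suc m \<oplus> n = suc (m \<oplus> n)"
  by (rule eq_induct[of "\<lambda>n. suc m \<oplus> n" "\<lambda>n. suc (m \<oplus> n)"]) (auto intro!: F1_I)

lemma add_sub_cancel [simp]: "(y \<oplus> x) \<ominus> x = y"
  by (rule eq_induct[of "\<lambda>x. (y \<oplus> x) \<ominus> x" "\<lambda>x. y"])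
    (auto intro!: F1_I simp: suc_sub_suc simp del: sub_simps(2))

lemma sub_add [simp]: "x \<ominus> (y \<oplus> x) = \<zero>"
  by (rule eq_induct[of "\<lambda>x. x \<ominus> (y \<oplus> x)" "\<lambda>x. \<zero>"])
    (auto intro!: F1_I simp: suc_sub_suc simp del: sub_simps(2))

lemma add_commute: "m \<oplus> n = n \<oplus> m"
  by (rule eq_induct[of "\<lambda>n. m \<oplus> n" "\<lambda>n. n \<oplus> m"]) (auto intro!: F1_I)

lemma add_left_cancel: "x \<oplus> y = x \<oplus> y' \<longleftrightarrow> y = y'"
  by (metis add_commute add_sub_cancel)

text \<open>An implication is not an equation, so where the hypothesis fails the left-hand side
  receives the default value \<open>y\<close>; the result is an unconditional equation, proved by
  induction on \<open>x\<close>.\<close>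

lemma add_sub_of_le: "x \<ominus> y = \<zero> \<Longrightarrow> x \<oplus> (y \<ominus> x) = y"
proof -
  have "(if x \<ominus> y = \<zero> then x \<oplus> (y \<ominus> x) else y) = y"
  proof (rule eq_induct[of "\<lambda>x. if x \<ominus> y = \<zero> then x \<oplus> (y \<ominus> x) else y" "\<lambda>x. y"])
    fix x assume IH: "(if x \<ominus> y = \<zero> then x \<oplus> (y \<ominus> x) else y) = y"
    show "(if suc x \<ominus> y = \<zero> then suc x \<oplus> (y \<ominus> suc x) else y) = y"
    proof (cases "suc x \<ominus> y = \<zero>")
      case True
      then have "x \<ominus> y = \<zero>" using pred_suc_sub[of x y] by simp
      then have eq: "x \<oplus> (y \<ominus> x) = y" using IH by simp
      show ?thesis
      proof (cases "y \<ominus> x" rule: zero_suc_cases)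
        \<comment> \<open>Here \<open>x = y\<close>, so \<open>suc x \<ominus> y\<close> would be
          \<open>suc \<zero>\<close>.\<close>
        case zero
        then show ?thesis using eq True by auto
      next
        case (suc k)
        then show ?thesis using eq True by auto
      qed
    qed simp
  qed (auto intro!: F1_I if_zero_F3)
  then show "x \<ominus> y = \<zero> \<Longrightarrow> x \<oplus> (y \<ominus> x) = y" by simp
qed

text \<open>Again a default value, now \<open>x\<close>, makes the claim an equation; the induction
  runs on \<open>y\<close>.\<close>

lemma add_sub_of_ge: "x \<ominus> y \<noteq> \<zero> \<Longrightarrow> y \<oplus> (x \<ominus> y) = x"
proof -
  have "(if x \<ominus> y = \<zero> then x else y \<oplus> (x \<ominus> y)) = x"
  proof (rule eq_induct[of "\<lambda>y. if x \<ominus> y = \<zero> then x else y \<oplus> (x \<ominus> y)" "\<lambda>y. x"])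
    fix y assume IH: "(if x \<ominus> y = \<zero> then x else y \<oplus> (x \<ominus> y)) = x"
    show "(if x \<ominus> suc y = \<zero> then x else suc y \<oplus> (x \<ominus> suc y)) = x"
      using IH by (cases "x \<ominus> y" rule: zero_suc_cases) auto
  qed (auto intro!: F1_I if_zero_F3)
  then show "x \<ominus> y \<noteq> \<zero> \<Longrightarrow> y \<oplus> (x \<ominus> y) = x" by (simp split: if_splits)
qed

text \<open>Turns a test for equality into two tests for zero, which \<open>if_zero_F3\<close> can
  handle.\<close>

lemma eq_iff_sub: "x = y \<longleftrightarrow> x \<ominus> y = \<zero> \<and> y \<ominus> x = \<zero>"
  using add_sub_of_le[of x y] by auto

lemma if_eq_F3 [intro!]:
  assumes "a \<in> F3" "b \<in> F3" "c \<in> F3" "d \<in> F3"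
  shows "(\<lambda>m n r. if c m n r = d m n r then a m n r else b m n r) \<in> F3"
proof -
  have "(\<lambda>m n r. if c m n r \<ominus> d m n r = \<zero>
      then if d m n r \<ominus> c m n r = \<zero> then a m n r else b m n r else b m n r) \<in> F3"
    by (intro if_zero_F3 sub_F3 assms)
  moreover have "(\<lambda>m n r. if c m n r \<ominus> d m n r = \<zero>
      then if d m n r \<ominus> c m n r = \<zero> then a m n r else b m n r else b m n r) =
      (\<lambda>m n r. if c m n r = d m n r then a m n r else b m n r)"
    by (auto simp: fun_eq_iff eq_iff_sub[of "c _ _ _"])
  ultimately show ?thesis by simp
qed

section \<open>The strict order\<close>

definition less :: "'a \<Rightarrow> 'a \<Rightarrow> bool"  (infix \<open>\<prec>\<close> 50) where
  "x \<prec> y \<longleftrightarrow> (\<exists>k. x \<oplus> suc k = y)"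

text \<open>Whether \<open>x \<ominus> y\<close> vanishes decides which of the two numbers is the
  other plus some \<open>k\<close>; then \<open>k\<close> is zero or a successor.\<close>

lemma less_linear: "x \<prec> y \<or> x = y \<or> y \<prec> x"
proof -
  have *: "x \<oplus> k = y \<Longrightarrow> x = y \<or> x \<prec> y" for x y k
    by (cases k rule: zero_suc_cases) (auto simp: less_def simp del: add_simps(2))
  show ?thesis
    using *[OF add_sub_of_le[of x y]] *[OF add_sub_of_ge[of x y]] by blast
qed

text \<open>The formula \<open>Less\<close> quantifies over any \<open>p\<close> obeying the
  recursion equations of addition; by induction on the second argument each such \<open>p\<close> is
  \<open>add\<close>, so that the formula expresses \<prec>.\<close>

lemma add_unique:
  assumes "p \<in> F2" "\<forall>m. p m \<zero> = m \<and> (\<forall>n. p m (suc n) = suc (p m n))"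
  shows "p = add"
proof (intro ext)
  fix m n
  show "p m n = m \<oplus> n"
    by (rule eq_induct[of "\<lambda>n. p m n" "\<lambda>n. m \<oplus> n"]) (use assms in \<open>auto intro!: F1_I comp2[OF assms(1)]\<close>)
qed

section \<open>Triangular numbers and Cantor pairing\<close>

definition tri :: "'a \<Rightarrow> 'a" where
  "tri = prim_rec (\<lambda>m. \<zero>) (\<lambda>m n r. suc (r \<oplus> n)) \<zero>"

lemma tri_simps [simp]: "tri \<zero> = \<zero>" "tri (suc n) = suc (tri n \<oplus> n)"
  by (auto simp: tri_def prim_rec_zero prim_rec_suc suc_F3 add_F3)

lemma tri_F3 [intro!]: "a \<in> F3 \<Longrightarrow> (\<lambda>m n r. tri (a m n r)) \<in> F3"
  unfolding tri_def by (auto intro!: prim_rec_F3)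

text \<open>The root of \<open>p\<close> is the largest \<open>k\<close> such that \<open>tri k\<close> is at most \<open>p\<close>.\<close>

definition root :: "'a \<Rightarrow> 'a" where
  "root = prim_rec (\<lambda>m. \<zero>) (\<lambda>m n r. if tri (suc r) = suc n then suc r else r) \<zero>"

lemma root_simps:
  "root \<zero> = \<zero>" "root (suc p) = (if tri (suc (root p)) = suc p then suc (root p) else root p)"
  unfolding root_def
  by (simp_all add: prim_rec_zero prim_rec_suc if_eq_F3 tri_F3 suc_F3 del: tri_simps)

lemma root_F3 [intro!]: "a \<in> F3 \<Longrightarrow> (\<lambda>m n r. root (a m n r)) \<in> F3"
  unfolding root_def by (auto intro!: prim_rec_F3)

text \<open>The diagonal numbered \<open>k\<close> runs from \<open>tri k\<close> to
  \<open>tri k \<oplus> k\<close>, and the next triangular number lies just past its end, so the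
  root stays constant on it. The induction on \<open>n\<close> uses the default value
  \<open>k\<close> past the end.\<close>

lemma root_add_aux:
  assumes "root (tri k) = k" "n \<ominus> k = \<zero>"
  shows "root (tri k \<oplus> n) = k"
proof -
  have "(if n \<ominus> k = \<zero> then root (tri k \<oplus> n) else k) = k"
  proof (rule eq_induct[of "\<lambda>n. if n \<ominus> k = \<zero> then root (tri k \<oplus> n) else k" "\<lambda>n. k"])
    fix n assume IH: "(if n \<ominus> k = \<zero> then root (tri k \<oplus> n) else k) = k"
    show "(if suc n \<ominus> k = \<zero> then root (tri k \<oplus> suc n) else k) = k"
    proof (cases "suc n \<ominus> k = \<zero>")
      case True
      then have "n \<ominus> k = \<zero>" using pred_suc_sub[of n k] by simp
      \<comment> \<open>Hence \<open>tri k \<oplus> suc n\<close> differs from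
        \<open>tri (suc k)\<close>, and the root does not increase.\<close>
      moreover have "n \<noteq> k" using True by auto
      ultimately show ?thesis using IH by (simp add: root_simps add_left_cancel)
    qed simp
  qed (use assms(1) in \<open>auto intro!: F1_I\<close>)
  then show ?thesis using assms(2) by simp
qed

text \<open>The last point of diagonal \<open>k\<close> has root \<open>k\<close>, and its successor
  is \<open>tri (suc k)\<close>, where the root increases by one.\<close>

lemma root_tri: "root (tri k) = k"
proof (rule eq_induct[of "\<lambda>k. root (tri k)" "\<lambda>k. k"])
  fix k assume "root (tri k) = k"
  then show "root (tri (suc k)) = suc k"
    using root_add_aux[of k k] by (simp add: root_simps)
qed (auto intro!: F1_I simp: root_simps)

definition pair :: "'a \<Rightarrow> 'a \<Rightarrow> 'a" where
  "pair m n = tri (m \<oplus> n) \<oplus> n"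

definition snd_of :: "'a \<Rightarrow> 'a" where
  "snd_of p = p \<ominus> tri (root p)"

definition fst_of :: "'a \<Rightarrow> 'a" where
  "fst_of p = root p \<ominus> snd_of p"

lemma pair_F3 [intro!]: "a \<in> F3 \<Longrightarrow> b \<in> F3 \<Longrightarrow> (\<lambda>m n r. pair (a m n r) (b m n r)) \<in> F3"
  unfolding pair_def by auto

lemma snd_of_F3 [intro!]: "a \<in> F3 \<Longrightarrow> (\<lambda>m n r. snd_of (a m n r)) \<in> F3"
  unfolding snd_of_def by auto

lemma fst_of_F3 [intro!]: "a \<in> F3 \<Longrightarrow> (\<lambda>m n r. fst_of (a m n r)) \<in> F3"
  unfolding fst_of_def by auto

text \<open>The pair lies on the diagonal numbered by the sum, at offset \<open>n\<close>, which is
  at most \<open>m \<oplus> n\<close>.\<close>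

lemma root_pair: "root (pair m n) = m \<oplus> n"
  unfolding pair_def by (rule root_add_aux) (simp_all add: root_tri)

lemma snd_of_pair [simp]: "snd_of (pair m n) = n"
  unfolding snd_of_def root_pair by (simp add: pair_def add_commute[of "tri _"])

lemma fst_of_pair [simp]: "fst_of (pair m n) = m"
  unfolding fst_of_def root_pair by simp

lemma pair_eq_iff [simp]: "pair m n = pair m' n' \<longleftrightarrow> m = m' \<and> n = n'"
  by (metis fst_of_pair snd_of_pair)


section \<open>Minimization and inverses of permutations in a model\<close>

definition is_least_zero :: "('a \<Rightarrow> 'a) \<Rightarrow> 'a \<Rightarrow> bool" where
  "is_least_zero f x \<longleftrightarrow> f x = \<zero> \<and> (\<forall>y. y \<prec> x \<longrightarrow> f y \<noteq> \<zero>)"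

definition min3 :: bool where
  "min3 \<longleftrightarrow> (\<forall>f\<in>F3. (\<forall>m n. \<exists>r. f m n r = \<zero>) \<longrightarrow>
     (\<exists>g\<in>F2. \<forall>m n. is_least_zero (f m n) (g m n)))"

definition min2 :: bool where
  "min2 \<longleftrightarrow> (\<forall>f\<in>F2. (\<forall>m. \<exists>n. f m n = \<zero>) \<longrightarrow> (\<exists>g\<in>F1. \<forall>m. is_least_zero (f m) (g m)))"

definition min1 :: bool where
  "min1 \<longleftrightarrow> (\<forall>f\<in>F2. (\<forall>m. \<exists>!n. f m n = \<zero>) \<longrightarrow> (\<exists>g\<in>F1. \<forall>m. f m (g m) = \<zero>))"

definition perm :: bool where
  "perm \<longleftrightarrow> (\<forall>f\<in>F1. (\<forall>n. \<exists>!m. f m = n) \<longrightarrow> (\<exists>g\<in>F1. \<forall>n. f (g n) = n))"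

section \<open>The cycle of implications\<close>

lemma min3_imp_min2:
  assumes min3
  shows min2
  unfolding min2_def
proof (intro ballI impI)
  fix f assume f: "f \<in> F2" "\<forall>m. \<exists>n. f m n = \<zero>"
  have "(\<lambda>m n r. f m r) \<in> F3" by (intro comp2[OF f(1)] proj_F3)
  then obtain g where g: "g \<in> F2" "\<And>m n. is_least_zero (f m) (g m n)"
    using assms[unfolded min3_def, rule_format, of "\<lambda>m n r. f m r"] f(2) by blast
  \<comment> \<open>The middle argument of the ternary function was a dummy, so the diagonal of
    \<open>g\<close> is as good as any of its sections.\<close>
  have "(\<lambda>m. g m m) \<in> F1" by (intro F1_I comp2[OF g(1)] proj_F3)
  then show "\<exists>g\<in>F1. \<forall>m. is_least_zero (f m) (g m)"
    using g(2) by (intro bexI[of _ "\<lambda>m. g m m"]) auto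
qed

lemma min2_imp_min1:
  assumes min2
  shows min1
  unfolding min1_def
proof (intro ballI impI)
  fix f assume f: "f \<in> F2" "\<forall>m. \<exists>!n. f m n = \<zero>"
  then have "\<forall>m. \<exists>n. f m n = \<zero>" by (meson ex1_implies_ex)
  then obtain g where "g \<in> F1" "\<forall>m. is_least_zero (f m) (g m)"
    using assms f(1) unfolding min2_def by meson
  then show "\<exists>g\<in>F1. \<forall>m. f m (g m) = \<zero>" unfolding is_least_zero_def by meson
qed

lemma min1_imp_perm:
  assumes min1
  shows perm
  unfolding perm_def
proof (intro ballI impI)
  fix f assume f: "f \<in> F1" "\<forall>n. \<exists>!m. f m = n"
  \<comment> \<open>Zero exactly on the graph of the inverse of \<open>f\<close>.\<close>
  define e where "e n m = (if f m = n then \<zero> else suc \<zero>)" for n m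
  have e: "e n m = \<zero> \<longleftrightarrow> f m = n" for n m by (simp add: e_def)
  have "e \<in> F2" unfolding e_def by (intro F2_I if_eq_F3 comp1[OF f(1)]) auto
  moreover have "\<forall>n. \<exists>!m. e n m = \<zero>" using f(2) by (simp add: e)
  ultimately have "\<exists>g\<in>F1. \<forall>n. e n (g n) = \<zero>"
    using assms unfolding min1_def by meson
  then show "\<exists>g\<in>F1. \<forall>n. f (g n) = n" by (simp add: e)
qed

text \<open>
  Rows are numbered by pairs \<open>q = \<langle>m, n\<rangle>\<close>, and \<open>free q r \<noteq> \<zero>\<close> says that \<open>f q\<close> has no zero below \<open>r\<close>. Hence
  \<open>step q\<close> only has to compare its argument with the least zero, not to compute the latter.
\<close>

lemma perm_imp_min3:
  assumes perm
  shows min3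
  unfolding min3_def
proof (intro ballI impI)
  fix k assume k: "k \<in> F3" and ex: "\<forall>m n. \<exists>r. k m n r = \<zero>"
  \<comment> \<open>Both parameters are packed into one, as primitive recursion carries only
    one.\<close>
  define f where "f q r = k (fst_of q) (snd_of q) r" for q r
  have f_F3: "(\<lambda>m n r. f (a m n r) (b m n r)) \<in> F3" if "a \<in> F3" "b \<in> F3" for a b
    unfolding f_def by (intro comp3[OF k] fst_of_F3 snd_of_F3 that)
  have ex_zero: "\<exists>r. f q r = \<zero>" for q unfolding f_def using ex by blast
  define free where "free = prim_rec (\<lambda>q. suc \<zero>) (\<lambda>q r x. if f q r = \<zero> then \<zero> else x)"
  have h_F3: "(\<lambda>q r x. if f q r = \<zero> then \<zero> else x) \<in> F3" by (intro if_eq_F3 f_F3) auto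
  have free_F2: "free \<in> F2" unfolding free_def by (rule prim_rec_F2[OF _ h_F3]) auto
  have free_zero [simp]: "free q \<zero> = suc \<zero>" for q
    unfolding free_def by (rule prim_rec_zero[OF _ h_F3]) auto
  have free_suc [simp]: "free q (suc r) = (if f q r = \<zero> then \<zero> else free q r)" for q r
    unfolding free_def by (rule prim_rec_suc[OF _ h_F3]) auto
  have free_less: "free q y = \<zero>" if "x \<prec> y" "f q x = \<zero>" for q x y
  proof -
    from that(1) obtain j where j: "y = x \<oplus> suc j" by (auto simp: less_def)
    \<comment> \<open>Once zero, \<open>free q\<close> stays zero; induction on the distance
      \<open>j\<close>.\<close>
    have "free q (suc (x \<oplus> j)) = \<zero>"
      by (rule eq_induct[of "\<lambda>j. free q (suc (x \<oplus> j))" "\<lambda>j. \<zero>"])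
        (auto intro!: F1_I f_F3 comp2[OF free_F2] simp: that(2))
    then show ?thesis by (simp add: j)
  qed
  \<comment> \<open>The least number principle by equational induction alone: without a first zero,
    \<open>free q\<close> would be constantly \<open>suc \<zero>\<close>, and then any zero of
    \<open>f q\<close> would be a first one.\<close>
  have ex_first: "\<exists>r. f q r = \<zero> \<and> free q r \<noteq> \<zero>" for q
  proof (rule ccontr)
    assume *: "\<nexists>r. f q r = \<zero> \<and> free q r \<noteq> \<zero>"
    have "free q r = suc \<zero>" for r
      by (rule eq_induct[of "\<lambda>r. free q r" "\<lambda>r. suc \<zero>"])
        (use * in \<open>auto intro!: F1_I comp2[OF free_F2]\<close>)
    then show False using * ex_zero[of q] by auto
  qed
  have first_unique: "x = y"
    if "f q x = \<zero>" "free q x \<noteq> \<zero>" "f q y = \<zero>" "free q y \<noteq> \<zero>" for q x y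
    using that free_less less_linear by metis

  \<comment> \<open>Beyond the least zero the row is fixed pointwise, so \<open>step q\<close>
    permutes the whole row; at the least zero the cycle closes.\<close>
  define step where
    "step q r = (if free q r = \<zero> then r else if f q r = \<zero> then \<zero> else suc r)" for q r
  have step_F3: "(\<lambda>m n r. step (a m n r) (b m n r)) \<in> F3" if "a \<in> F3" "b \<in> F3" for a b
    unfolding step_def by (intro if_eq_F3 f_F3 comp2[OF free_F2] that suc_F3 const_F3)
  have step_surj: "\<exists>r. step q r = x" for q x
  proof (cases x rule: zero_suc_cases)
    case zero
    then show ?thesis using ex_first[of q] by (auto simp: step_def)
  next
    case (suc y)
    show ?thesis
    proof (cases "free q x = \<zero>")
      case True
      then show ?thesis by (auto simp: step_def)
    next
      case False
      \<comment> \<open>As \<open>free q (suc y)\<close> is nonzero, \<open>y\<close> is before the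
        least zero.\<close>
      then have "step q y = x" by (auto simp: step_def suc split: if_splits)
      then show ?thesis ..
    qed
  qed
  \<comment> \<open>The cycle and the fixed part of a row are each mapped into themselves.\<close>
  have step_neq: "step q r \<noteq> step q r'" if "free q r = \<zero>" "free q r' \<noteq> \<zero>" for q r r'
  proof (cases "f q r' = \<zero>")
    case True
    have "r \<noteq> \<zero>" using that(1) free_zero suc_neq_zero by metis
    then show ?thesis using True that by (simp add: step_def)
  next
    case False
    then have "free q (suc r') \<noteq> \<zero>" using that(2) by simp
    then have "r \<noteq> suc r'" using that(1) by metis
    then show ?thesis using False that by (simp add: step_def)
  qed
  have step_inj: "r = r'" if "step q r = step q r'" for q r r'
  proof -
    have eq: "free q r = \<zero> \<longleftrightarrow> free q r' = \<zero>"
      using step_neq that by metis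
    show ?thesis
    proof (cases "free q r = \<zero>")
      case True
      then show ?thesis using that eq by (simp add: step_def)
    next
      case False
      then show ?thesis
        using that eq first_unique[of q r r']
        by (cases "f q r = \<zero>"; cases "f q r' = \<zero>") (simp_all add: step_def suc_neq_zero[symmetric])
    qed
  qed
  have step_zero: "f q r = \<zero> \<and> free q r \<noteq> \<zero>" if "step q r = \<zero>" for q r
    using that by (auto simp: step_def split: if_splits)

  \<comment> \<open>Numbers failing the test for being a code are left fixed, and codes go to codes
    of the same row; bijectivity thus reduces to that of each \<open>step q\<close>.\<close>
  define \<pi> where
    "\<pi> p = (if pair (fst_of p) (snd_of p) = p then pair (fst_of p) (step (fst_of p) (snd_of p))
       else p)" for p
  have "\<pi> \<in> F1" unfolding \<pi>_def by (intro F1_I if_eq_F3 pair_F3 step_F3) auto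
  moreover have "\<exists>!p. \<pi> p = x" for x
  proof (rule ex_ex1I)
    show "\<exists>p. \<pi> p = x"
    proof (cases "pair (fst_of x) (snd_of x) = x")
      case True
      obtain r where "step (fst_of x) r = snd_of x" using step_surj by blast
      then have "\<pi> (pair (fst_of x) r) = x" using True by (simp add: \<pi>_def)
      then show ?thesis ..
    next
      case False
      then have "\<pi> x = x" by (simp add: \<pi>_def)
      then show ?thesis ..
    qed
  next
    fix p p' assume "\<pi> p = x" "\<pi> p' = x"
    then have eq: "\<pi> p = \<pi> p'" by simp
    show "p = p'"
    proof (cases "pair (fst_of p) (snd_of p) = p \<and> pair (fst_of p') (snd_of p') = p'")
      case True
      then have "fst_of p = fst_of p' \<and> snd_of p = snd_of p'"
        using eq step_inj by (simp add: \<pi>_def) metis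
      then show ?thesis using True by metis
    next
      case False
      \<comment> \<open>Two non-codes are fixed; a code and a non-code cannot have the same
        image.\<close>
      then show ?thesis using eq unfolding \<pi>_def by (metis fst_of_pair snd_of_pair)
    qed
  qed
  ultimately obtain inv where inv: "inv \<in> F1" "\<And>x. \<pi> (inv x) = x"
    using assms unfolding perm_def by blast
  \<comment> \<open>The point sent to the start of row \<open>pair m n\<close> is the one where the
    cycle closes, that is, the least zero.\<close>
  define g where "g m n = snd_of (inv (pair (pair m n) \<zero>))" for m n
  have "g \<in> F2" unfolding g_def by (intro F2_I snd_of_F3 comp1[OF inv(1)]) auto
  moreover have "is_least_zero (k m n) (g m n)" for m n
  proof -
    define p where "p = inv (pair (pair m n) \<zero>)"
    have p: "\<pi> p = pair (pair m n) \<zero>" using inv(2) p_def by simp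
    \<comment> \<open>A non-code would be its own image, but this image is a code.\<close>
    then have "pair (fst_of p) (snd_of p) = p" unfolding \<pi>_def by (metis fst_of_pair snd_of_pair)
    then have "fst_of p = pair m n" "step (fst_of p) (snd_of p) = \<zero>" using p by (auto simp: \<pi>_def)
    then have "f (pair m n) (g m n) = \<zero> \<and> free (pair m n) (g m n) \<noteq> \<zero>"
      using step_zero unfolding g_def p_def by metis
    then have "is_least_zero (f (pair m n)) (g m n)"
      using free_less unfolding is_least_zero_def by blast
    moreover have "f (pair m n) = k m n" by (simp add: f_def fun_eq_iff)
    ultimately show ?thesis by simp
  qed
  ultimately show "\<exists>g\<in>F2. \<forall>m n. is_least_zero (k m n) (g m n)" by blast
qed

lemma principles_equivalent: "min3 = min2" "min2 = min1" "min1 = perm"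
  using min3_imp_min2 min2_imp_min1 min1_imp_perm perm_imp_min3 by blast+

end


section \<open>Models of the theory\<close>

context interp
begin

lemma sat_abbrevs [simp]:
  "sat e f g h (\<^bold>\<not> p) \<longleftrightarrow> \<not> sat e f g h p"
  "sat e f g h (p \<^bold>\<and> q) \<longleftrightarrow> sat e f g h p \<and> sat e f g h q"
  "sat e f g h (p \<^bold>\<longleftrightarrow> q) \<longleftrightarrow> (sat e f g h p \<longleftrightarrow> sat e f g h q)"
  "sat e f g h (ExN p) \<longleftrightarrow> (\<exists>x. sat (case_nat x e) f g h p)"
  "sat e f g h (ExF Una p) \<longleftrightarrow> (\<exists>\<phi>\<in>F1. sat e (case_nat \<phi> f) g h p)"
  "sat e f g h (ExF Bin p) \<longleftrightarrow> (\<exists>\<phi>\<in>F2. sat e f (case_nat \<phi> g) h p)"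
  "sat e f g h (ExF Ter p) \<longleftrightarrow> (\<exists>\<phi>\<in>F3. sat e f g (case_nat \<phi> h) p)"
  by (auto simp: Neg_def Conj_def Iff_def ExN_def ExF_def)

lemma trm_val_lift_trm_N [simp]:
  "trm_val (case_nat x e) f g h (lift_trm_N t) = trm_val e f g h t"
  by (induction t) (simp_all add: lift_trm_N_def)

lemma trm_val_lift_trm_F [simp]:
  "trm_val e f (case_nat \<phi> g) h (lift_trm_F Bin t) = trm_val e f g h t"
  by (induction t) (simp_all add: lift_trm_F_def suc_fun_def)

lemma pra_model_of_sat:
  assumes "\<forall>q\<in>PRA_fcn. sat e f g h q"
  shows "pra_model zero suc F1 F2 F3"
proof -
  have successor: "\<forall>q\<in>successor_axioms. sat e f g h q"
    and initial: "\<forall>q\<in>initial_function_axioms. sat e f g h q"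
    and composition: "\<forall>q\<in>composition_axioms. sat e f g h q"
    and recursion: "sat e f g h primitive_recursion_axiom"
    and induction: "sat e f g h rudimentary_induction_axiom"
    using assms unfolding PRA_fcn_def by blast+
  note successor = successor[unfolded successor_axioms_def, simplified]
  note initial = initial[unfolded initial_function_axioms_def, simplified]
  note composition = composition[unfolded composition_axioms_def, simplified]
  note recursion = recursion[unfolded primitive_recursion_axiom_def, simplified]
  note induction = induction[unfolded rudimentary_induction_axiom_def, simplified]
  show ?thesis
  proof
    show "suc n \<noteq> zero" for n
      using successor by blast
    show "suc n = suc m \<longleftrightarrow> n = m" for n m
      using successor by blast
    show "n \<noteq> zero \<Longrightarrow> \<exists>m. suc m = n" for n
      using successor by blast
    show "\<exists>f\<in>F1. \<forall>m. f m = n" for n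
      using initial by blast
    show "\<exists>f\<in>F3. \<forall>m n r. f m n r = m" "\<exists>f\<in>F3. \<forall>m n r. f m n r = n"
      "\<exists>f\<in>F3. \<forall>m n r. f m n r = r"
      using initial by blast+
    show "\<exists>f\<in>F1. \<forall>n. f n = suc n"
      using initial by blast
    show "\<exists>f\<in>F3. \<forall>m n r. f m n r = \<phi> m n" if "\<phi> \<in> F2" for \<phi>
      using composition that by blast
    show "\<exists>f\<in>F3. \<forall>m n r. f m n r = \<phi> m" if "\<phi> \<in> F1" for \<phi>
      using composition that by blast
    show "\<exists>f\<in>F2. \<forall>m n. f m n = \<phi> m n r" if "\<phi> \<in> F3" for \<phi> r
      using composition that by blast
    show "\<exists>f\<in>F1. \<forall>m. f m = \<phi> m n r" if "\<phi> \<in> F3" for \<phi> n r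
      using composition that by blast
    show "\<exists>f\<in>F3. \<forall>m n r. f m n r = \<phi> (a m n r) (b m n r) (c m n r)"
      if "\<phi> \<in> F3" "a \<in> F3" "b \<in> F3" "c \<in> F3" for \<phi> a b c
      using composition that by blast
    show "\<exists>f\<in>F2. \<forall>m. f m zero = \<phi> m \<and> (\<forall>n. f m (suc n) = a m n (f m n))"
      if "\<phi> \<in> F1" "a \<in> F3" for \<phi> a
      using recursion that by blast
    show "\<phi> n = \<psi> n" if "\<phi> \<in> F1" "\<psi> \<in> F1" "\<phi> zero = \<psi> zero"
      "\<And>n. \<phi> n = \<psi> n \<Longrightarrow> \<phi> (suc n) = \<psi> (suc n)" for \<phi> \<psi> n
      using induction that by blast
  qed
qed

end

context pra_model
begin

sublocale interp zero suc F1 F2 F3 .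

lemma sat_Less [simp]:
  "sat e f g h (t \<^bold>< u) \<longleftrightarrow> trm_val e f g h t \<prec> trm_val e f g h u"
proof -
  have "(\<exists>p\<in>F2. (\<forall>m. p m \<zero> = m \<and> (\<forall>n. p m (suc n) = suc (p m n))) \<and>
      (\<exists>k. p x (suc k) = y)) \<longleftrightarrow> x \<prec> y" for x y
    unfolding less_def using add_unique add_F2 add_simps by metis
  then show ?thesis by (simp add: Less_def)
qed

lemma sat_MIN3: "sat e f g h MIN3 \<longleftrightarrow> min3"
  by (simp add: MIN3_def min3_def is_least_zero_def Is_mu_def inst_N_def numeral_eq_Suc)

lemma sat_MIN2: "sat e f g h MIN2 \<longleftrightarrow> min2"
  by (simp add: MIN2_def min2_def is_least_zero_def Is_mu_def inst_N_def)

lemma sat_MIN1: "sat e f g h MIN1 \<longleftrightarrow> min1"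
  by (simp add: MIN1_def min1_def Ex1N_def Ex1_def numeral_eq_Suc)

lemma sat_PERM: "sat e f g h PERM \<longleftrightarrow> perm"
  by (simp add: PERM_def perm_def Ex1N_def Ex1_def numeral_eq_Suc)

end

theorem theorem2:
  shows "\<forall>p \<in> {MIN3, MIN2, MIN1, PERM}. \<forall>q \<in> {MIN3, MIN2, MIN1, PERM}. PRA_fcn \<turnstile> p \<^bold>\<longleftrightarrow> q"
proof (intro ballI)
  fix p q assume pq: "p \<in> {MIN3, MIN2, MIN1, PERM}" "q \<in> {MIN3, MIN2, MIN1, PERM}"
  show "PRA_fcn \<turnstile> p \<^bold>\<longleftrightarrow> q"
  proof (rule completeness)
    show "finite PRA_fcn"
      by (simp add: PRA_fcn_def successor_axioms_def initial_function_axioms_def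
          composition_axioms_def)
    show "successor_axioms \<subseteq> PRA_fcn"
      by (auto simp: PRA_fcn_def)
  next
    fix zero suc F1 F2 F3 and e :: "nat \<Rightarrow> nat" and f g h
    assume "\<forall>\<phi>\<in>PRA_fcn. interp.sat zero suc F1 F2 F3 e f g h \<phi>"
    then interpret pra_model zero suc F1 F2 F3
      by (rule interp.pra_model_of_sat)
    show "sat e f g h (p \<^bold>\<longleftrightarrow> q)"
      using pq principles_equivalent by (auto simp: sat_MIN3 sat_MIN2 sat_MIN1 sat_PERM)
  qed
qed

end
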